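(* Let $\Bbbk$ be a Noetherian commutative domain such that $\mathbb{Z}\to\Bbbk$ is injective, and let $R_n=\Bbbk[x_1,\dots,x_n]$. For $p=\sum_{i=1}^na_ix_i\in R_n$ with $a_i\in\mathbb{Z}$ there is an isomorphism of $\mathfrak{sl}_2$-modules $$R_n\langle p\rangle\cong\nabla(a_1)\otimes\cdots\otimes\nabla(a_n).$$ In particular, $\mathrm{core}(R_n\langle p\rangle)$ is nonzero if and only if $a_i\in\mathbb{Z}_{\le0}$ for all $i$, in which case $$\mathrm{core}(R_n\langle p\rangle)\cong L_{a_1}\otimes\cdots\otimes L_{a_n}.$$
   Context: $\mathfrak{sl}_2$ has standard triple $(\mathbf{d},\mathbf{h},-\mathbf{z})$, so $[\mathbf{h},\mathbf{d}]=2\mathbf{d}$, $[\mathbf{h},\mathbf{z}]=-2\mathbf{z}$, $\mathbf{z}\mathbf{d}-\mathbf{d}\mathbf{z}=\mathbf{h}$. $R_n$ is graded with $\deg x_i=2$ and has the $\mathfrak{sl}_2$-action $\mathbf{d}=\sum_ix_i^2\frac{\partial}{\partial x_i}$, $\mathbf{z}=\sum_i\frac{\partial}{\partial x_i}$, $\mathbf{h}$ = multiplication by degree. $R_n\langle p\rangle$ is the free rank one graded $R_n$-module with generator $1_p$ in degree $\sum_ia_i$, with $\mathfrak{sl}_2$-action determined by $\mathbf{d}(1_p)=p\cdot1_p$, $\mathbf{z}(1_p)=0$, $\mathbf{h}(1_p)=\left(\sum_ia_i\right)1_p$ and the Leibniz rule $\mathbf{x}(rm)=\mathbf{x}(r)m+r\,\mathbf{x}(m)$.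 For $k\in\mathbb{Z}$, $\nabla(k)$ is the free $\Bbbk$-module with basis $\{w_{k,m}\}_{m\ge0}$, $w_{k,m}$ of weight $k+2m$, and $\mathbf{d}(w_{k,m})=(m+k)w_{k,m+1}$, $\mathbf{z}(w_{k,m+1})=(m+1)w_{k,m}$, $\mathbf{z}(w_{k,0})=0$. For $k\le0$, $L_k$ denotes the submodule of $\nabla(k)$ with $\Bbbk$-basis $w_{k,0},\dots,w_{k,-k}$ (when $\Bbbk$ is a field of characteristic zero, this is the irreducible representation of lowest weight $k$). Tensor products are over $\Bbbk$. An $\mathfrak{sl}_2$-module is bounded if it is a weight module with integral weights, its weights are bounded below, and every weight space is free of finite rank over $\Bbbk$. The core of a bounded module $M$ is its maximal $\mathfrak{sl}_2$-submodule that is finitely generated over $\Bbbk$; equivalently $\mathrm{core}(M)=\{m\in M\mid\mathbf{d}^N(m)=0\text{ for some }N\}$. *)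

theory Defs
  imports
    "HOL-Library.Poly_Mapping"
    "HOL-Algebra.Algebraic_Closure_Type"
    "HOL-Algebra.Ring_Divisibility"
begin

text \<open>The base ring is a type \<open>'k\<close>; \<open>ring_of_type_algebra\<close> is the library's view of it as a
  HOL-Algebra ring, so that modules, submodules and Noetherianity are the notions of HOL-Algebra.\<close>

abbreviation base_ring :: "'k::comm_ring_1 ring"
  where "base_ring \<equiv> ring_of_type_algebra"


section \<open>Modules over sl2\<close>

text \<open>A HOL-Algebra module record has (unused) fields for a multiplication and a unit.
  Since sl2 is free over the base ring with basis \<open>d\<close>, \<open>h\<close>, \<open>z\<close>, an action of it is given by
  three linear operators satisfying the bracket relations.\<close>

record ('k, 'v) sl2_rep = "('k, 'v) module" +
  dop :: "'v \<Rightarrow> 'v"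
  hop :: "'v \<Rightarrow> 'v"
  zop :: "'v \<Rightarrow> 'v"

definition with_action ::
    "('k, 'v) module \<Rightarrow> ('v \<Rightarrow> 'v) \<Rightarrow> ('v \<Rightarrow> 'v) \<Rightarrow> ('v \<Rightarrow> 'v) \<Rightarrow> ('k, 'v) sl2_rep"
  where "with_action M d h z = module.extend M (sl2_rep.fields d h z)"

definition linear_endo :: "('k::comm_ring_1, 'v, 'm) module_scheme \<Rightarrow> ('v \<Rightarrow> 'v) \<Rightarrow> bool"
  where "linear_endo M f \<longleftrightarrow>
    f \<in> carrier M \<rightarrow> carrier M \<and>
    (\<forall>x\<in>carrier M. \<forall>y\<in>carrier M. f (x \<oplus>\<^bsub>M\<^esub> y) = f x \<oplus>\<^bsub>M\<^esub> f y) \<and>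
    (\<forall>c. \<forall>x\<in>carrier M. f (c \<odot>\<^bsub>M\<^esub> x) = c \<odot>\<^bsub>M\<^esub> f x)"

definition sl2_module :: "('k::comm_ring_1, 'v) sl2_rep \<Rightarrow> bool"
  where "sl2_module M \<longleftrightarrow>
    module base_ring M \<and>
    linear_endo M (dop M) \<and> linear_endo M (hop M) \<and> linear_endo M (zop M) \<and>
    (\<forall>x\<in>carrier M.
      hop M (dop M x) \<ominus>\<^bsub>M\<^esub> dop M (hop M x) = 2 \<odot>\<^bsub>M\<^esub> dop M x \<and>
      hop M (zop M x) \<ominus>\<^bsub>M\<^esub> zop M (hop M x) = (- 2) \<odot>\<^bsub>M\<^esub> zop M x \<and>
      zop M (dop M x) \<ominus>\<^bsub>M\<^esub> dop M (zop M x) = hop M x)"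

definition sl2_iso :: "('k::comm_ring_1, 'v) sl2_rep \<Rightarrow> ('k, 'w) sl2_rep \<Rightarrow> bool"
    (infix \<open>\<cong>\<^sub>s\<^sub>l\<close> 50)
  where "M \<cong>\<^sub>s\<^sub>l N \<longleftrightarrow> sl2_module M \<and> sl2_module N \<and>
    (\<exists>\<phi>. bij_betw \<phi> (carrier M) (carrier N) \<and>
      (\<forall>x\<in>carrier M. \<forall>y\<in>carrier M. \<phi> (x \<oplus>\<^bsub>M\<^esub> y) = \<phi> x \<oplus>\<^bsub>N\<^esub> \<phi> y) \<and>
      (\<forall>c. \<forall>x\<in>carrier M. \<phi> (c \<odot>\<^bsub>M\<^esub> x) = c \<odot>\<^bsub>N\<^esub> \<phi> x) \<and>
      (\<forall>x\<in>carrier M. \<phi> (dop M x) = dop N (\<phi> x)) \<and>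
      (\<forall>x\<in>carrier M. \<phi> (hop M x) = hop N (\<phi> x)) \<and>
      (\<forall>x\<in>carrier M. \<phi> (zop M x) = zop N (\<phi> x)))"

definition sl2_submodule :: "'v set \<Rightarrow> ('k::comm_ring_1, 'v) sl2_rep \<Rightarrow> bool"
  where "sl2_submodule C M \<longleftrightarrow> submodule C base_ring M \<and>
    dop M \<in> C \<rightarrow> C \<and> hop M \<in> C \<rightarrow> C \<and> zop M \<in> C \<rightarrow> C"

definition submodule_span :: "('k::comm_ring_1, 'v, 'm) module_scheme \<Rightarrow> 'v set \<Rightarrow> 'v set"
  where "submodule_span M A = (\<lambda>T. submodule T base_ring M) hull A"

definition finitely_generated :: "'v set \<Rightarrow> ('k::comm_ring_1, 'v, 'm) module_scheme \<Rightarrow> bool"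
  where "finitely_generated C M \<longleftrightarrow> (\<exists>A\<subseteq>carrier M. finite A \<and> C = submodule_span M A)"

text \<open>Sums of two finitely generated submodules are again such, so ``maximal'' means greatest
  with respect to inclusion. The value is unspecified if there is no greatest one (this does
  not happen for bounded modules over a Noetherian ring).\<close>

definition core :: "('k::comm_ring_1, 'v) sl2_rep \<Rightarrow> 'v set"
  where "core M = (GREATEST C. sl2_submodule C M \<and> finitely_generated C M)"

definition sl2_core :: "('k::comm_ring_1, 'v) sl2_rep \<Rightarrow> ('k, 'v) sl2_rep"
  where "sl2_core M = M\<lparr>carrier := core M\<rparr>"


section \<open>Free modules\<close>

definition scale :: "'k \<Rightarrow> ('b \<Rightarrow>\<^sub>0 'k) \<Rightarrow> ('b \<Rightarrow>\<^sub>0 'k::comm_ring_1)"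
  where "scale c f = Poly_Mapping.map ((*) c) f"

definition free_module :: "'b set \<Rightarrow> ('k::comm_ring_1, 'b \<Rightarrow>\<^sub>0 'k) module"
  where "free_module B =
    \<lparr>carrier = {f. Poly_Mapping.keys f \<subseteq> B}, monoid.mult = undefined, one = undefined,
     ring.zero = 0, add = (+), module.smult = scale\<rparr>"

text \<open>\<open>lin_extend g\<close> is the linear map sending the basis vector \<open>Poly_Mapping.single b 1\<close>
  to \<open>g b\<close>.\<close>

definition lin_extend :: "('b \<Rightarrow> ('c \<Rightarrow>\<^sub>0 'k)) \<Rightarrow> ('b \<Rightarrow>\<^sub>0 'k) \<Rightarrow> ('c \<Rightarrow>\<^sub>0 'k::comm_ring_1)"
  where "lin_extend g f = (\<Sum>b\<in>Poly_Mapping.keys f. scale (Poly_Mapping.lookup f b) (g b))"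


section \<open>The modules \<open>\<nabla>(k)\<close> and \<open>L\<^sub>k\<close>\<close>

text \<open>The basis vector \<open>w\<^sub>k\<^sub>,\<^sub>m\<close> is \<open>Poly_Mapping.single m 1\<close>.\<close>

definition nabla :: "int \<Rightarrow> ('k::comm_ring_1, nat \<Rightarrow>\<^sub>0 'k) sl2_rep"
  where "nabla k = with_action (free_module UNIV)
    (lin_extend (\<lambda>m. Poly_Mapping.single (Suc m) (of_int (int m + k))))
    (lin_extend (\<lambda>m. Poly_Mapping.single m (of_int (k + 2 * int m))))
    (lin_extend (\<lambda>m. case m of 0 \<Rightarrow> 0 | Suc j \<Rightarrow> Poly_Mapping.single j (of_nat (Suc j))))"

text \<open>Only meaningful for \<open>k \<le> 0\<close>.\<close>

definition L_mod :: "int \<Rightarrow> ('k::comm_ring_1, nat \<Rightarrow>\<^sub>0 'k) sl2_rep"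
  where "L_mod k = (nabla k)\<lparr>carrier := {f. \<forall>m\<in>Poly_Mapping.keys f. int m \<le> - k}\<rparr>"


section \<open>The twisted polynomial representation\<close>

text \<open>Polynomials in variables indexed by the naturals are finitely supported maps
  from exponent vectors to coefficients; their product is the library's convolution product.\<close>

type_synonym 'k mpoly = "(nat \<Rightarrow>\<^sub>0 nat) \<Rightarrow>\<^sub>0 'k"

definition indet :: "nat \<Rightarrow> 'k::comm_ring_1 mpoly"
  where "indet i = Poly_Mapping.single (Poly_Mapping.single i 1) 1"

definition partial_deriv :: "nat \<Rightarrow> 'k::comm_ring_1 mpoly \<Rightarrow> 'k mpoly"
  where "partial_deriv i = lin_extend (\<lambda>m.
    Poly_Mapping.single (m - Poly_Mapping.single i 1) (of_nat (Poly_Mapping.lookup m i)))"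

definition monom_degree :: "(nat \<Rightarrow>\<^sub>0 nat) \<Rightarrow> nat"
  where "monom_degree m = (\<Sum>i\<in>Poly_Mapping.keys m. 2 * Poly_Mapping.lookup m i)"

definition degree_op :: "'k::comm_ring_1 mpoly \<Rightarrow> 'k mpoly"
  where "degree_op = lin_extend (\<lambda>m. Poly_Mapping.single m (of_nat (monom_degree m)))"

definition poly_monoms :: "nat \<Rightarrow> (nat \<Rightarrow>\<^sub>0 nat) set"
  where "poly_monoms n = {m. Poly_Mapping.keys m \<subseteq> {1..n}}"

definition linear_form :: "nat \<Rightarrow> (nat \<Rightarrow> int) \<Rightarrow> 'k::comm_ring_1 mpoly"
  where "linear_form n a = (\<Sum>i=1..n. of_int (a i) * indet i)"

text \<open>\<open>R\<^sub>n\<langle>p\<rangle>\<close> for \<open>p = linear_form n a\<close>. The element \<open>r \<cdot> 1\<^sub>p\<close> is represented by the polynomial \<open>r\<close>,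
  and each operator is \<open>x(r \<cdot> 1\<^sub>p) = x(r) \<cdot> 1\<^sub>p + r \<cdot> x(1\<^sub>p)\<close>, with \<open>d(1\<^sub>p) = p \<cdot> 1\<^sub>p\<close>,
  \<open>h(1\<^sub>p) = (\<Sum>i. a\<^sub>i) \<cdot> 1\<^sub>p\<close> and \<open>z(1\<^sub>p) = 0\<close>.\<close>

definition twisted_poly :: "nat \<Rightarrow> (nat \<Rightarrow> int) \<Rightarrow> ('k::comm_ring_1, 'k mpoly) sl2_rep"
  where "twisted_poly n a = with_action (free_module (poly_monoms n))
    (\<lambda>r. (\<Sum>i=1..n. (indet i)\<^sup>2 * partial_deriv i r) + r * linear_form n a)
    (\<lambda>r. degree_op r + r * of_int (\<Sum>i=1..n. a i))
    (\<lambda>r. \<Sum>i=1..n. partial_deriv i r)"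


section \<open>Tensor products\<close>

text \<open>The tensor product over the base ring of a family of modules indexed by \<open>I\<close>: the quotient
  of the free module on all tuples by the multilinearity relations. The class of
  \<open>Poly_Mapping.single t 1\<close> is the pure tensor of the tuple \<open>t\<close>. For empty \<open>I\<close> this is the base
  ring.\<close>

definition tuples :: "'i set \<Rightarrow> ('i \<Rightarrow> ('k, 'v) sl2_rep) \<Rightarrow> ('i \<Rightarrow> 'v) set"
  where "tuples I M = (\<Pi>\<^sub>E i\<in>I. carrier (M i))"

abbreviation gen :: "'b \<Rightarrow> ('b \<Rightarrow>\<^sub>0 'k::comm_ring_1)"
  where "gen b \<equiv> Poly_Mapping.single b 1"

definition multilin_relators ::
    "'i set \<Rightarrow> ('i \<Rightarrow> ('k::comm_ring_1, 'v) sl2_rep) \<Rightarrow> (('i \<Rightarrow> 'v) \<Rightarrow>\<^sub>0 'k) set"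
  where "multilin_relators I M =
    {gen (t(i := x \<oplus>\<^bsub>M i\<^esub> y)) - gen (t(i := x)) - gen (t(i := y)) | t i x y.
      t \<in> tuples I M \<and> i \<in> I \<and> x \<in> carrier (M i) \<and> y \<in> carrier (M i)} \<union>
    {gen (t(i := c \<odot>\<^bsub>M i\<^esub> x)) - scale c (gen (t(i := x))) | t i c x.
      t \<in> tuples I M \<and> i \<in> I \<and> x \<in> carrier (M i)}"

definition tensor_rel ::
    "'i set \<Rightarrow> ('i \<Rightarrow> ('k::comm_ring_1, 'v) sl2_rep) \<Rightarrow>
      ((('i \<Rightarrow> 'v) \<Rightarrow>\<^sub>0 'k) \<times> (('i \<Rightarrow> 'v) \<Rightarrow>\<^sub>0 'k)) set"
  where "tensor_rel I M = {(f, g).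
    f \<in> carrier (free_module (tuples I M)) \<and> g \<in> carrier (free_module (tuples I M)) \<and>
    f - g \<in> submodule_span (free_module (tuples I M)) (multilin_relators I M)}"

text \<open>\<open>quot_map r T\<close> is the map induced on classes by a map \<open>T\<close> that respects \<open>r\<close>,
  in the style of \<open>UN_equiv_class\<close>.\<close>

definition quot_map :: "('f \<times> 'f) set \<Rightarrow> ('f \<Rightarrow> 'f) \<Rightarrow> 'f set \<Rightarrow> 'f set"
  where "quot_map r T C = (\<Union>f\<in>C. r `` {T f})"

definition tensor_module ::
    "'i set \<Rightarrow> ('i \<Rightarrow> ('k::comm_ring_1, 'v) sl2_rep) \<Rightarrow> ('k, (('i \<Rightarrow> 'v) \<Rightarrow>\<^sub>0 'k) set) module"
  where "tensor_module I M =
    \<lparr>carrier = carrier (free_module (tuples I M)) // tensor_rel I M,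
     monoid.mult = undefined, one = undefined,
     ring.zero = tensor_rel I M `` {0},
     add = (\<lambda>C D. \<Union>f\<in>C. \<Union>g\<in>D. tensor_rel I M `` {f + g}),
     module.smult = (\<lambda>c. quot_map (tensor_rel I M) (scale c))\<rparr>"

text \<open>\<open>\<xi>\<close> acts on pure tensors by the Leibniz rule
  \<open>\<xi>(t\<^sub>1 \<otimes> \<dots> \<otimes> t\<^sub>n) = (\<Sum>i. t\<^sub>1 \<otimes> \<dots> \<otimes> \<xi> t\<^sub>i \<otimes> \<dots> \<otimes> t\<^sub>n)\<close>.\<close>

definition tensor_action ::
    "'i set \<Rightarrow> ('i \<Rightarrow> ('k::comm_ring_1, 'v) sl2_rep) \<Rightarrow> (('k, 'v) sl2_rep \<Rightarrow> 'v \<Rightarrow> 'v) \<Rightarrow>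
      (('i \<Rightarrow> 'v) \<Rightarrow>\<^sub>0 'k) set \<Rightarrow> (('i \<Rightarrow> 'v) \<Rightarrow>\<^sub>0 'k) set"
  where "tensor_action I M \<xi> = quot_map (tensor_rel I M)
    (lin_extend (\<lambda>t. \<Sum>i\<in>I. gen (t(i := \<xi> (M i) (t i)))))"

definition tensor ::
    "'i set \<Rightarrow> ('i \<Rightarrow> ('k::comm_ring_1, 'v) sl2_rep) \<Rightarrow> ('k, (('i \<Rightarrow> 'v) \<Rightarrow>\<^sub>0 'k) set) sl2_rep"
  where "tensor I M = with_action (tensor_module I M)
    (tensor_action I M dop) (tensor_action I M hop) (tensor_action I M zop)"

end

theory Submission
  imports Defs
begin

text \<open>Under the correspondence of the monomial with exponents \<open>m\<^sub>1, \<dots>, m\<^sub>n\<close> and the pure tensor of the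
  \<open>w\<^bsub>a\<^sub>i, m\<^sub>i\<^esub>\<close>, the operators of the twisted representation become the Leibniz rule of the operators of
  \<open>\<nabla>(a\<^sub>i)\<close>. For instance \<open>d\<close> sends a monomial to the sum over \<open>i\<close> of \<open>m\<^sub>i + a\<^sub>i\<close> times the monomial with \<open>m\<^sub>i\<close>
  raised by one: the summand \<open>m\<^sub>i\<close> comes from differentiation and \<open>a\<^sub>i\<close> from the linear form
  (\<open>twisted_d\<close>, \<open>twisted_h\<close>, \<open>twisted_z\<close>). It remains to see that the pure tensors of basis vectors form a
  basis of the tensor product. They span because every entry can be expanded in its basis
  (\<open>pure_tensor_expansion\<close>). They are independent because a tensor can be multiplied out into a
  polynomial, which recovers the monomial (\<open>multiply_expand\<close>). The tensor product satisfies the bracket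
  relations because off-diagonal terms of iterated Leibniz rules cancel (\<open>leibniz_commutator\<close>), and the
  polynomial side inherits them through the injective map (\<open>sl2_module_if_embeds\<close>).

  The comparison is made for spans of basis vectors indexed by stable sets \<open>S i\<close>
  (\<open>twisted_on_iso\<close>). The full sets give the first isomorphism. The sets \<open>m \<le> - a\<^sub>i\<close> give the modules
  \<open>L\<close> on the tensor side, and the span of the box of monomials with \<open>m\<^sub>i \<le> - a\<^sub>i\<close> on the polynomial side.

  This box spans the core (\<open>core_twisted_poly\<close>). It is finite and closed under the action, since the
  coefficient \<open>m\<^sub>i + a\<^sub>i\<close> of \<open>d\<close> vanishes on its boundary. Conversely, if an element has a monomial with
  \<open>m\<^sub>i > - a\<^sub>i\<close>, then each application of \<open>d\<close> raises the highest such \<open>x\<^sub>i\<close>-exponent, because the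
  coefficient is a nonzero integer in a domain of characteristic zero. Such an element lies in no
  finitely generated submodule stable under \<open>d\<close> (\<open>d_raises_top_exponent\<close>, \<open>finitely_generated_below_core\<close>). The box is
  nonempty exactly if all \<open>a\<^sub>i\<close> are nonpositive, in which case it contains the constant monomial.\<close>

section \<open>Linear maps between free modules\<close>

lemma lookup_scale [simp]: "Poly_Mapping.lookup (scale c f) b = c * Poly_Mapping.lookup f b"
  by (simp add: scale_def Poly_Mapping.map.rep_eq when_def)

interpretation free: Modules.module "scale :: 'k::comm_ring_1 \<Rightarrow> ('b \<Rightarrow>\<^sub>0 'k) \<Rightarrow> ('b \<Rightarrow>\<^sub>0 'k)"
  by unfold_locales (auto intro!: poly_mapping_eqI simp: lookup_add algebra_simps)

interpretation free_pair: Modules.module_pair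
  "scale :: 'k::comm_ring_1 \<Rightarrow> ('b \<Rightarrow>\<^sub>0 'k) \<Rightarrow> ('b \<Rightarrow>\<^sub>0 'k)"
  "scale :: 'k::comm_ring_1 \<Rightarrow> ('c \<Rightarrow>\<^sub>0 'k) \<Rightarrow> ('c \<Rightarrow>\<^sub>0 'k)"
  by unfold_locales

abbreviation linear_map :: "(('b \<Rightarrow>\<^sub>0 'k) \<Rightarrow> ('c \<Rightarrow>\<^sub>0 'k::comm_ring_1)) \<Rightarrow> bool"
  where "linear_map \<equiv> Modules.module_hom scale scale"

lemma linear_mapI:
  assumes "\<And>f g. F (f + g) = F f + F g" "\<And>c f. F (scale c f) = scale c (F f)"
  shows "linear_map F"
  using assms by (simp add: module_hom_iff free.module_axioms)

lemmas linear_map_add = module_hom.add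
  and linear_map_scale = module_hom.scale
  and linear_map_diff = module_hom.diff
  and linear_map_sum = module_hom.sum

lemma scale_single [simp]: "scale c (Poly_Mapping.single b d) = Poly_Mapping.single b (c * d)"
  by (rule poly_mapping_eqI) (simp add: lookup_single when_def)

lemma keys_scale_subset: "Poly_Mapping.keys (scale c f) \<subseteq> Poly_Mapping.keys f"
  by (auto simp: in_keys_iff)

lemma keys_subset_add:
  "Poly_Mapping.keys f \<subseteq> B \<Longrightarrow> Poly_Mapping.keys g \<subseteq> B \<Longrightarrow> Poly_Mapping.keys (f + g) \<subseteq> B"
  by (rule order_trans[OF keys_add]) simp

lemma keys_subset_diff:
  "Poly_Mapping.keys f \<subseteq> B \<Longrightarrow> Poly_Mapping.keys g \<subseteq> B \<Longrightarrow> Poly_Mapping.keys (f - g) \<subseteq> B"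
  by (rule order_trans[OF keys_diff]) simp

lemma keys_subset_scale: "Poly_Mapping.keys f \<subseteq> B \<Longrightarrow> Poly_Mapping.keys (scale c f) \<subseteq> B"
  by (rule order_trans[OF keys_scale_subset])

lemma lin_extend_eq_sum:
  assumes "finite B" "Poly_Mapping.keys f \<subseteq> B"
  shows "lin_extend g f = (\<Sum>b\<in>B. scale (Poly_Mapping.lookup f b) (g b))"
  unfolding lin_extend_def using assms
  by (intro sum.mono_neutral_left) (auto simp: in_keys_iff)

lemma linear_map_lin_extend: "linear_map (lin_extend (g :: 'a \<Rightarrow> ('c \<Rightarrow>\<^sub>0 'b::comm_ring_1)))"
proof (rule linear_mapI)
  fix f h :: "'a \<Rightarrow>\<^sub>0 'b"
  let ?B = "Poly_Mapping.keys f \<union> Poly_Mapping.keys h"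
  have "Poly_Mapping.keys (f + h) \<subseteq> ?B" by (rule keys_add)
  then show "lin_extend g (f + h) = lin_extend g f + lin_extend g h"
    by (simp add: lin_extend_eq_sum[where B = ?B] lookup_add free.scale_left_distrib sum.distrib)
next
  fix c and f :: "'a \<Rightarrow>\<^sub>0 'b"
  show "lin_extend g (scale c f) = scale c (lin_extend g f)"
    by (simp add: lin_extend_eq_sum[where B = "Poly_Mapping.keys f"] keys_scale_subset
        free.scale_sum_right)
qed

lemma lin_extend_single [simp]: "lin_extend g (Poly_Mapping.single b c) = scale c (g b)"
  by (simp add: lin_extend_eq_sum[where B = "{b}"])

lemma subspace_keys_subset: "free.subspace {f. Poly_Mapping.keys f \<subseteq> B}"
  unfolding free.subspace_def
  by (simp add: keys_subset_add keys_subset_scale)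

lemma keys_subset_sum:
  "(\<And>i. i \<in> I \<Longrightarrow> Poly_Mapping.keys (f i) \<subseteq> B) \<Longrightarrow>
    Poly_Mapping.keys (\<Sum>i\<in>I. f i :: _ \<Rightarrow>\<^sub>0 'k::comm_ring_1) \<subseteq> B"
  using free.subspace_sum[OF subspace_keys_subset, of I f B] by simp

text \<open>Elements supported on a set of basis vectors form a span, so that span induction reduces every
  statement about linear maps on them to the basis vectors.\<close>

lemma keys_subset_eq_span: "{f :: 'a \<Rightarrow>\<^sub>0 'b::comm_ring_1. Poly_Mapping.keys f \<subseteq> B} = free.span (gen ` B)"
proof (rule antisym)
  show "free.span (gen ` B) \<subseteq> {f. Poly_Mapping.keys f \<subseteq> B}"
    by (intro free.span_minimal subspace_keys_subset) auto
next
  show "{f :: 'a \<Rightarrow>\<^sub>0 'b::comm_ring_1. Poly_Mapping.keys f \<subseteq> B} \<subseteq> free.span (gen ` B)"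
  proof clarify
    fix f :: "'a \<Rightarrow>\<^sub>0 'b" assume f: "Poly_Mapping.keys f \<subseteq> B"
    have "f = (\<Sum>b\<in>Poly_Mapping.keys f. Poly_Mapping.single b (Poly_Mapping.lookup f b))"
      by (rule poly_mapping_eqI) (auto simp: lookup_sum lookup_single when_def in_keys_iff)
    also have "\<dots> = (\<Sum>b\<in>Poly_Mapping.keys f. scale (Poly_Mapping.lookup f b) (gen b))"
      by simp
    also have "\<dots> \<in> free.span (gen ` B)"
      using f by (intro free.span_sum free.span_scale free.span_base) auto
    finally show "f \<in> free.span (gen ` B)" .
  qed
qed

lemma linear_map_eqI:
  assumes "linear_map F" "linear_map G" "\<And>b. b \<in> B \<Longrightarrow> F (gen b) = G (gen b)"
    and "Poly_Mapping.keys f \<subseteq> B"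
  shows "F f = G f"
  using free_pair.module_hom_eq_on_span[OF assms(1,2), of "gen ` B" f] assms(3,4)
    keys_subset_eq_span by blast

lemma linear_map_ext:
  assumes "linear_map F" "linear_map G" "\<And>b. F (gen b) = G (gen b)"
  shows "F = G"
  using linear_map_eqI[OF assms(1,2), of UNIV] assms(3) by auto

lemma linear_map_keys_subset:
  assumes F: "linear_map F" and gen: "\<And>b. b \<in> B \<Longrightarrow> Poly_Mapping.keys (F (gen b)) \<subseteq> C"
    and f: "Poly_Mapping.keys f \<subseteq> B"
  shows "Poly_Mapping.keys (F f) \<subseteq> C"
proof -
  have "free.span (gen ` B) \<subseteq> {f. F f \<in> {g. Poly_Mapping.keys g \<subseteq> C}}"
    using gen by (intro free.span_minimal module_hom.subspace_linear_preimage[OF F]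
        subspace_keys_subset) auto
  then show ?thesis using f by (auto simp: keys_subset_eq_span[symmetric])
qed

lemma lin_extend_keys_subset:
  assumes "\<And>b. b \<in> B \<Longrightarrow> Poly_Mapping.keys (g b) \<subseteq> C" "Poly_Mapping.keys f \<subseteq> B"
  shows "Poly_Mapping.keys (lin_extend g f) \<subseteq> C"
  using assms by (intro linear_map_keys_subset[OF linear_map_lin_extend _ assms(2)]) simp

section \<open>Submodules of free modules\<close>

lemma base_ring_simps [simp]:
  "carrier base_ring = UNIV" "monoid.mult base_ring = (*)" "one base_ring = 1"
  "ring.zero base_ring = 0" "add base_ring = (+)"
  by (simp_all add: ring_of_type_algebra_def fun_eq_iff)

text \<open>The carrier is a submodule of the free module on \<open>'b\<close> and the structure is inherited from it.
  On such records the HOL-Algebra notions of submodule and generated submodule become the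
  subspaces and spans of \<^locale>\<open>Modules.module\<close>.\<close>

definition inside_free :: "('k::comm_ring_1, 'b \<Rightarrow>\<^sub>0 'k, 'm) module_scheme \<Rightarrow> bool"
  where "inside_free M \<longleftrightarrow> free.subspace (carrier M) \<and>
    ring.zero M = 0 \<and> add M = (+) \<and> module.smult M = scale"

lemma module_of_subspace:
  fixes M :: "('k::comm_ring_1, 'b \<Rightarrow>\<^sub>0 'k, 'm) module_scheme"
  assumes "inside_free M"
  shows "Module.module base_ring M"
proof (intro moduleI abelian_groupI cring_from_type_algebra)
  fix x assume "x \<in> carrier M"
  then show "\<exists>y\<in>carrier M. y \<oplus>\<^bsub>M\<^esub> x = \<zero>\<^bsub>M\<^esub>"
    using assms free.subspace_neg[of "carrier M" x] unfolding inside_free_def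
    by (intro bexI[of _ "- x"]) simp_all
qed (use assms in \<open>simp_all add: inside_free_def free.subspace_def add_ac
    free.scale_left_distrib free.scale_right_distrib\<close>)

lemma a_inv_of_subspace:
  fixes M :: "('k::comm_ring_1, 'b \<Rightarrow>\<^sub>0 'k, 'm) module_scheme"
  assumes "inside_free M"
    and "x \<in> carrier M"
  shows "\<ominus>\<^bsub>M\<^esub> x = - x"
proof -
  interpret Module.module base_ring M by (rule module_of_subspace) fact
  show ?thesis
    using assms free.subspace_neg[of "carrier M" x] unfolding inside_free_def
    by (intro minus_equality) simp_all
qed

lemma submodule_iff_subspace:
  fixes M :: "('k::comm_ring_1, 'b \<Rightarrow>\<^sub>0 'k, 'm) module_scheme"
  assumes "inside_free M"
  shows "submodule N base_ring M \<longleftrightarrow> N \<subseteq> carrier M \<and> free.subspace N"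
proof -
  interpret Module.module base_ring M by (rule module_of_subspace) fact
  show ?thesis
  proof
    assume "submodule N base_ring M"
    note N = submoduleE[OF this]
    have scale: "scale c x \<in> N" if "x \<in> N" for c x
      using N(4)[of c x] that assms by (simp add: inside_free_def)
    obtain x where "x \<in> N" using N(2) by blast
    then have "0 \<in> N" using scale[of x 0] by simp
    moreover have "x + y \<in> N" if "x \<in> N" "y \<in> N" for x y
      using N(5)[OF that] assms by (simp add: inside_free_def)
    ultimately show "N \<subseteq> carrier M \<and> free.subspace N"
      using N(1) scale by (simp add: free.subspace_def)
  next
    assume N: "N \<subseteq> carrier M \<and> free.subspace N"
    then have "\<ominus>\<^bsub>M\<^esub> x \<in> N" if "x \<in> N" for x
      using a_inv_of_subspace[OF assms, of x] free.subspace_neg[of N x] that by auto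
    then show "submodule N base_ring M"
      using assms N unfolding inside_free_def free.subspace_def by (intro submoduleI) simp_all
  qed
qed

lemma submodule_span_eq_span:
  fixes M :: "('k::comm_ring_1, 'b \<Rightarrow>\<^sub>0 'k, 'm) module_scheme"
  assumes "inside_free M"
    and "A \<subseteq> carrier M"
  shows "submodule_span M A = free.span A"
  unfolding submodule_span_def
proof (rule hull_unique)
  show "A \<subseteq> free.span A" by (rule free.span_superset)
  show "submodule (free.span A) base_ring M"
    using assms by (simp add: submodule_iff_subspace) (simp add: inside_free_def free.span_minimal)
  show "free.span A \<subseteq> T" if "A \<subseteq> T" "submodule T base_ring M" for T
    using that assms by (simp add: submodule_iff_subspace free.span_minimal)
qed

section \<open>Tensor products of representations\<close>

lemma with_action_simps [simp]:
  "carrier (with_action M d h z) = carrier M" "ring.zero (with_action M d h z) = ring.zero M"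
  "add (with_action M d h z) = add M" "module.smult (with_action M d h z) = module.smult M"
  "dop (with_action M d h z) = d" "hop (with_action M d h z) = h" "zop (with_action M d h z) = z"
  by (simp_all add: with_action_def module.defs sl2_rep.defs)

lemma free_module_simps [simp]:
  "carrier (free_module B) = {f. Poly_Mapping.keys f \<subseteq> B}" "ring.zero (free_module B) = 0"
  "add (free_module B) = (+)" "module.smult (free_module B) = scale"
  by (simp_all add: free_module_def)

lemma inside_free_free_module: "inside_free (free_module B)"
  by (simp add: inside_free_def subspace_keys_subset)

lemma tuplesD: "t \<in> tuples I M \<Longrightarrow> i \<in> I \<Longrightarrow> t i \<in> carrier (M i)"
  by (auto simp: tuples_def)

lemma tuples_upd: "t \<in> tuples I M \<Longrightarrow> i \<in> I \<Longrightarrow> x \<in> carrier (M i) \<Longrightarrow> t(i := x) \<in> tuples I M"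
  by (auto simp: tuples_def PiE_def Pi_def extensional_def)

locale module_family =
  fixes I :: "'i set" and M :: "'i \<Rightarrow> ('k::comm_ring_1, 'v) sl2_rep"
  assumes module: "i \<in> I \<Longrightarrow> Module.module base_ring (M i)"
begin

lemma smult_carrier: "i \<in> I \<Longrightarrow> x \<in> carrier (M i) \<Longrightarrow> c \<odot>\<^bsub>M i\<^esub> x \<in> carrier (M i)"
  using module.smult_closed[OF module] by simp

lemma add_carrier:
  "i \<in> I \<Longrightarrow> x \<in> carrier (M i) \<Longrightarrow> y \<in> carrier (M i) \<Longrightarrow> x \<oplus>\<^bsub>M i\<^esub> y \<in> carrier (M i)"
  using module[of i] by (simp add: module_def abelian_group_def abelian_monoid.a_closed)

abbreviation combos :: "(('i \<Rightarrow> 'v) \<Rightarrow>\<^sub>0 'k) set"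
  where "combos \<equiv> {f. Poly_Mapping.keys f \<subseteq> tuples I M}"

abbreviation relations :: "(('i \<Rightarrow> 'v) \<Rightarrow>\<^sub>0 'k) set"
  where "relations \<equiv> free.span (multilin_relators I M)"

abbreviation cls :: "(('i \<Rightarrow> 'v) \<Rightarrow>\<^sub>0 'k) \<Rightarrow> (('i \<Rightarrow> 'v) \<Rightarrow>\<^sub>0 'k) set"
  where "cls f \<equiv> tensor_rel I M `` {f}"

lemma relators_combos: "multilin_relators I M \<subseteq> combos"
  by (auto simp: multilin_relators_def tuples_upd add_carrier smult_carrier
      dest!: subsetD[OF keys_diff] subsetD[OF keys_scale_subset] split: if_splits)

lemma tensor_rel_iff:
  "(f, g) \<in> tensor_rel I M \<longleftrightarrow> f \<in> combos \<and> g \<in> combos \<and> f - g \<in> relations"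
  using relators_combos
  by (simp add: tensor_rel_def submodule_span_eq_span inside_free_free_module)

lemma relator_add:
  assumes "t \<in> tuples I M" "i \<in> I" "x \<in> carrier (M i)" "y \<in> carrier (M i)"
  shows "gen (t(i := x \<oplus>\<^bsub>M i\<^esub> y)) - gen (t(i := x)) - gen (t(i := y)) \<in> relations"
  using assms by (intro free.span_base) (auto simp: multilin_relators_def)

lemma relator_smult:
  assumes "t \<in> tuples I M" "i \<in> I" "x \<in> carrier (M i)"
  shows "gen (t(i := c \<odot>\<^bsub>M i\<^esub> x)) - scale c (gen (t(i := x))) \<in> relations"
  using assms unfolding multilin_relators_def by (intro free.span_base) blast

lemma relations_induct [consumes 1, case_names subspace add smult]:
  assumes f: "f \<in> relations" and "free.subspace {f. P f}"
    and add: "\<And>t i x y. t \<in> tuples I M \<Longrightarrow> i \<in> I \<Longrightarrow> x \<in> carrier (M i) \<Longrightarrow> y \<in> carrier (M i) \<Longrightarrow>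
      P (gen (t(i := x \<oplus>\<^bsub>M i\<^esub> y)) - gen (t(i := x)) - gen (t(i := y)))"
    and smult: "\<And>t i c x. t \<in> tuples I M \<Longrightarrow> i \<in> I \<Longrightarrow> x \<in> carrier (M i) \<Longrightarrow>
      P (gen (t(i := c \<odot>\<^bsub>M i\<^esub> x)) - scale c (gen (t(i := x))))"
  shows "P f"
proof -
  have "multilin_relators I M \<subseteq> {f. P f}"
    unfolding multilin_relators_def using add smult by blast
  then show ?thesis using free.span_minimal[OF _ assms(2)] f by blast
qed

lemma equiv_tensor_rel: "equiv combos (tensor_rel I M)"
proof (rule equivI)
  show "refl_on combos (tensor_rel I M)"
    by (auto simp: refl_on_def tensor_rel_iff free.span_zero)
  show "sym (tensor_rel I M)"
    using free.span_neg by (fastforce simp: sym_def tensor_rel_iff)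
  show "trans (tensor_rel I M)"
  proof (rule transI)
    fix f g h assume *: "(f, g) \<in> tensor_rel I M" "(g, h) \<in> tensor_rel I M"
    then have "(f - g) + (g - h) \<in> relations" by (intro free.span_add) (simp_all add: tensor_rel_iff)
    with * show "(f, h) \<in> tensor_rel I M" by (simp add: tensor_rel_iff)
  qed
qed (auto simp: tensor_rel_iff)

lemma cls_eq_iff:
  assumes "f \<in> combos" "g \<in> combos"
  shows "cls f = cls g \<longleftrightarrow> f - g \<in> relations"
  using eq_equiv_class_iff[OF equiv_tensor_rel assms] assms by (simp add: tensor_rel_iff)

lemma carrier_tensor: "carrier (tensor I M) = cls ` combos"
  by (auto simp: tensor_def tensor_module_def quotient_def)

lemma zero_tensor: "\<zero>\<^bsub>tensor I M\<^esub> = cls 0"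
  by (simp add: tensor_def tensor_module_def)

lemma add_cls:
  assumes "f \<in> combos" "g \<in> combos"
  shows "cls f \<oplus>\<^bsub>tensor I M\<^esub> cls g = cls (f + g)"
proof -
  have "congruent2 (tensor_rel I M) (tensor_rel I M) (\<lambda>f g. cls (f + g))"
  proof (rule congruent2I[OF equiv_tensor_rel equiv_tensor_rel])
    fix f g h assume "(f, g) \<in> tensor_rel I M" and "h \<in> combos"
    then show "cls (f + h) = cls (g + h)" 
      by (subst cls_eq_iff) (simp_all add: tensor_rel_iff keys_subset_add)
  next
    fix f g h assume "(f, g) \<in> tensor_rel I M" and "h \<in> combos"
    then show "cls (h + f) = cls (h + g)" 
      by (subst cls_eq_iff) (simp_all add: tensor_rel_iff keys_subset_add)
  qed
  then show ?thesis
    using UN_equiv_class2[OF equiv_tensor_rel equiv_tensor_rel _ assms]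
    by (simp add: tensor_def tensor_module_def)
qed

lemma quot_map_cls:
  assumes T: "linear_map T" "\<And>t. t \<in> tuples I M \<Longrightarrow> T (gen t) \<in> combos"
    "\<And>f. f \<in> relations \<Longrightarrow> T f \<in> relations"
    and f: "f \<in> combos"
  shows "T f \<in> combos" and "quot_map (tensor_rel I M) T (cls f) = cls (T f)"
proof -
  have combos: "T g \<in> combos" if "g \<in> combos" for g
  proof -
    have "free.span (gen ` tuples I M) \<subseteq> {g. T g \<in> combos}"
      using T(2) by (intro free.span_minimal module_hom.subspace_linear_preimage[OF T(1)]
          subspace_keys_subset) auto
    then show ?thesis using that by (auto simp: keys_subset_eq_span[symmetric])
  qed
  then show "T f \<in> combos" using f .
  have "congruent (tensor_rel I M) (\<lambda>f. cls (T f))"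
    using combos T(3) by (intro congruentI)
      (auto simp: cls_eq_iff tensor_rel_iff simp flip: linear_map_diff[OF T(1)])
  from UN_equiv_class[OF equiv_tensor_rel this f]
  show "quot_map (tensor_rel I M) T (cls f) = cls (T f)" by (simp add: quot_map_def)
qed

lemma smult_cls:
  assumes "f \<in> combos"
  shows "c \<odot>\<^bsub>tensor I M\<^esub> cls f = cls (scale c f)"
proof -
  have "linear_map (scale c :: (('i \<Rightarrow> 'v) \<Rightarrow>\<^sub>0 'k) \<Rightarrow> _)"
    by (simp add: free.module_hom_scale_self)
  from quot_map_cls(2)[OF this] show ?thesis
    using assms by (simp add: tensor_def tensor_module_def free.span_scale)
qed

text \<open>A representative, on formal combinations of tuples, of the action on the tensor product.\<close>

definition leibniz :: "(('k, 'v) sl2_rep \<Rightarrow> 'v \<Rightarrow> 'v) \<Rightarrow> (('i \<Rightarrow> 'v) \<Rightarrow>\<^sub>0 'k) \<Rightarrow> (('i \<Rightarrow> 'v) \<Rightarrow>\<^sub>0 'k)"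
  where "leibniz \<xi> = lin_extend (\<lambda>t. \<Sum>i\<in>I. gen (t(i := \<xi> (M i) (t i))))"

lemma linear_map_leibniz: "linear_map (leibniz \<xi>)"
  unfolding leibniz_def by (rule linear_map_lin_extend)

lemma leibniz_gen: "leibniz \<xi> (gen t) = (\<Sum>i\<in>I. gen (t(i := \<xi> (M i) (t i))))"
  by (simp add: leibniz_def)

text \<open>The operator \<open>\<xi>\<close> stands for one of the selectors \<open>dop\<close>, \<open>hop\<close>, \<open>zop\<close>, which are
  treated uniformly.\<close>

definition acts :: "(('k, 'v) sl2_rep \<Rightarrow> 'v \<Rightarrow> 'v) \<Rightarrow> bool"
  where "acts \<xi> \<longleftrightarrow> (\<forall>i\<in>I. linear_endo (M i) (\<xi> (M i)))"

lemma actsD: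
  assumes "acts \<xi>" "i \<in> I" "x \<in> carrier (M i)"
  shows "\<xi> (M i) x \<in> carrier (M i)"
    and "y \<in> carrier (M i) \<Longrightarrow> \<xi> (M i) (x \<oplus>\<^bsub>M i\<^esub> y) = \<xi> (M i) x \<oplus>\<^bsub>M i\<^esub> \<xi> (M i) y"
    and "\<xi> (M i) (c \<odot>\<^bsub>M i\<^esub> x) = c \<odot>\<^bsub>M i\<^esub> \<xi> (M i) x"
  using assms by (auto simp: acts_def linear_endo_def)

lemma leibniz_gen_combos:
  assumes "acts \<xi>" "t \<in> tuples I M"
  shows "leibniz \<xi> (gen t) \<in> combos"
  unfolding leibniz_gen using assms
  by (intro free.subspace_sum subspace_keys_subset) (auto simp: tuples_upd tuplesD actsD)

text \<open>Changing the entry \<open>j\<close> of a tuple to its image under \<open>\<xi>\<close> commutes with changing another entry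
  \<open>i\<close>, and at \<open>j = i\<close> the linearity of \<open>\<xi>\<close> applies. Hence each summand of the Leibniz rule turns a
  multilinearity relator into a relator of the same kind.\<close>

lemma leibniz_relations:
  assumes \<xi>: "acts \<xi>" and "f \<in> relations"
  shows "leibniz \<xi> f \<in> relations"
proof -
  note lin = linear_map_leibniz[of \<xi>]
  have swap: "t(i := u, j := v) = t(j := v, i := u)" if "j \<noteq> i" for t :: "'i \<Rightarrow> 'v" and i j u v
    using that by (simp add: fun_upd_twist)
  show ?thesis
    using assms(2)
  proof (induction rule: relations_induct)
    case subspace
    show ?case by (intro module_hom.subspace_linear_preimage[OF lin] free.subspace_span)
  next
    case (add t i x y)
    have "gen ((t(i := x \<oplus>\<^bsub>M i\<^esub> y))(j := \<xi> (M j) ((t(i := x \<oplus>\<^bsub>M i\<^esub> y)) j)))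
        - gen ((t(i := x))(j := \<xi> (M j) ((t(i := x)) j)))
        - gen ((t(i := y))(j := \<xi> (M j) ((t(i := y)) j))) \<in> relations" if "j \<in> I" for j
    proof (cases "j = i")
      case True
      then show ?thesis
        using add relator_add[of t i "\<xi> (M i) x" "\<xi> (M i) y"] by (simp add: actsD[OF \<xi>])
    next
      case False
      then show ?thesis
        using add that relator_add[of "t(j := \<xi> (M j) (t j))" i x y]
        by (simp add: actsD[OF \<xi>] tuples_upd tuplesD swap)
    qed
    then have "(\<Sum>j\<in>I. gen ((t(i := x \<oplus>\<^bsub>M i\<^esub> y))(j := \<xi> (M j) ((t(i := x \<oplus>\<^bsub>M i\<^esub> y)) j)))
        - gen ((t(i := x))(j := \<xi> (M j) ((t(i := x)) j)))
        - gen ((t(i := y))(j := \<xi> (M j) ((t(i := y)) j)))) \<in> relations"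
      by (rule free.span_sum)
    then show ?case
      by (simp only: linear_map_diff[OF lin] leibniz_gen sum_subtractf)
  next
    case (smult t i c x)
    have "gen ((t(i := c \<odot>\<^bsub>M i\<^esub> x))(j := \<xi> (M j) ((t(i := c \<odot>\<^bsub>M i\<^esub> x)) j)))
        - scale c (gen ((t(i := x))(j := \<xi> (M j) ((t(i := x)) j)))) \<in> relations" if "j \<in> I" for j
    proof (cases "j = i")
      case True
      then show ?thesis
        using smult relator_smult[of t i "\<xi> (M i) x" c] by (simp add: actsD[OF \<xi>])
    next
      case False
      then show ?thesis
        using smult that relator_smult[of "t(j := \<xi> (M j) (t j))" i x c]
        by (simp add: actsD[OF \<xi>] tuples_upd tuplesD swap)
    qed
    then have "(\<Sum>j\<in>I. gen ((t(i := c \<odot>\<^bsub>M i\<^esub> x))(j := \<xi> (M j) ((t(i := c \<odot>\<^bsub>M i\<^esub> x)) j)))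
        - scale c (gen ((t(i := x))(j := \<xi> (M j) ((t(i := x)) j))))) \<in> relations"
      by (rule free.span_sum)
    then show ?case
      by (simp only: linear_map_diff[OF lin] linear_map_scale[OF lin] leibniz_gen
          sum_subtractf free.scale_sum_right)
  qed
qed

lemma tensor_action_cls:
  assumes "acts \<xi>" "f \<in> combos"
  shows "Poly_Mapping.keys (leibniz \<xi> f) \<subseteq> tuples I M"
    and "tensor_action I M \<xi> (cls f) = cls (leibniz \<xi> f)"
  using quot_map_cls[OF linear_map_leibniz leibniz_gen_combos leibniz_relations] assms
  by (auto simp: tensor_action_def leibniz_def)

lemma module_tensor: "Module.module base_ring (tensor I M)"
proof (intro moduleI abelian_groupI cring_from_type_algebra)
  fix x assume "x \<in> carrier (tensor I M)"
  then obtain f where "x = cls f" "f \<in> combos" by (auto simp: carrier_tensor)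
  then show "\<exists>y\<in>carrier (tensor I M). y \<oplus>\<^bsub>tensor I M\<^esub> x = \<zero>\<^bsub>tensor I M\<^esub>"
    by (intro bexI[of _ "cls (- f)"]) (auto simp: add_cls zero_tensor carrier_tensor)
qed (auto simp: carrier_tensor zero_tensor add_cls smult_cls add_ac free.scale_left_distrib
    free.scale_right_distrib keys_subset_add keys_subset_scale)

lemma minus_cls:
  assumes "f \<in> combos" "g \<in> combos"
  shows "cls f \<ominus>\<^bsub>tensor I M\<^esub> cls g = cls (f - g)"
proof -
  interpret T: Module.module base_ring "tensor I M" by (rule module_tensor)
  have "\<ominus>\<^bsub>tensor I M\<^esub> cls g = cls (- g)"
    using assms(2) by (intro T.minus_equality) (auto simp: add_cls zero_tensor carrier_tensor)
  then show ?thesis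
    using assms by (simp add: a_minus_def add_cls)
qed

lemma linear_endo_tensor_action:
  assumes "acts \<xi>"
  shows "linear_endo (tensor I M) (tensor_action I M \<xi>)"
  unfolding linear_endo_def using assms
  by (auto simp: carrier_tensor tensor_action_cls add_cls smult_cls
      keys_subset_add keys_subset_scale
      linear_map_add[OF linear_map_leibniz] linear_map_scale[OF linear_map_leibniz])

text \<open>Two iterated Leibniz rules contain the same off-diagonal terms, with \<open>\<xi>\<close> and \<open>\<eta>\<close> applied to
  different entries. Only the diagonal terms survive in the commutator, and there the bracket
  relation of the single factor applies. The scalar \<open>c\<close> covers the three bracket relations of sl2 at
  once.\<close>

lemma leibniz_commutator:
  assumes "finite I" and \<xi>: "acts \<xi>" and \<eta>: "acts \<eta>" and \<zeta>: "acts \<zeta>"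
    and bracket: "\<And>i x. i \<in> I \<Longrightarrow> x \<in> carrier (M i) \<Longrightarrow>
      \<xi> (M i) (\<eta> (M i) x) \<ominus>\<^bsub>M i\<^esub> \<eta> (M i) (\<xi> (M i) x) = c \<odot>\<^bsub>M i\<^esub> \<zeta> (M i) x"
    and f: "f \<in> combos"
  shows "leibniz \<xi> (leibniz \<eta> f) - leibniz \<eta> (leibniz \<xi> f) - scale c (leibniz \<zeta> f) \<in> relations"
proof -
  define T where "T f = leibniz \<xi> (leibniz \<eta> f) - leibniz \<eta> (leibniz \<xi> f) - scale c (leibniz \<zeta> f)"
    for f
  have T: "linear_map T"
    by (rule linear_mapI) (simp_all add: T_def linear_map_add[OF linear_map_leibniz]
        linear_map_scale[OF linear_map_leibniz] free.scale_right_diff_distrib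
        free.scale_right_distrib mult.commute)
  have "T (gen t) \<in> relations" if t: "t \<in> tuples I M" for t
  proof -
    define u where "u \<xi> i = \<xi> (M i) (t i)" for \<xi> :: "('k, 'v) sl2_rep \<Rightarrow> 'v \<Rightarrow> 'v" and i
    have double: "leibniz \<xi> (leibniz \<eta> (gen t)) =
        (\<Sum>i\<in>I. gen (t(i := \<xi> (M i) (u \<eta> i)))) + (\<Sum>i\<in>I. \<Sum>j\<in>I-{i}. gen (t(i := u \<eta> i, j := u \<xi> j)))"
      for \<xi> \<eta> :: "('k, 'v) sl2_rep \<Rightarrow> 'v \<Rightarrow> 'v"
    proof -
      have "leibniz \<xi> (leibniz \<eta> (gen t)) =
          (\<Sum>i\<in>I. \<Sum>j\<in>I. gen (t(i := u \<eta> i, j := \<xi> (M j) ((t(i := u \<eta> i)) j))))"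
        by (simp add: leibniz_gen linear_map_sum[OF linear_map_leibniz] u_def)
      also have "\<dots> = (\<Sum>i\<in>I. gen (t(i := \<xi> (M i) (u \<eta> i))) +
          (\<Sum>j\<in>I-{i}. gen (t(i := u \<eta> i, j := u \<xi> j))))"
        using \<open>finite I\<close> by (intro sum.cong refl) (subst sum.remove, auto simp: u_def intro!: sum.cong)
      finally show ?thesis by (simp add: sum.distrib)
    qed
    have sym: "(\<Sum>i\<in>I. \<Sum>j\<in>I-{i}. gen (t(i := u \<eta> i, j := u \<xi> j))) =
        (\<Sum>i\<in>I. \<Sum>j\<in>I-{i}. gen (t(i := u \<xi> i, j := u \<eta> j)))" (is "?l = ?r")
    proof -
      have "?l = (\<Sum>i\<in>I. \<Sum>j\<in>{j. j \<in> I \<and> i \<noteq> j}. gen (t(i := u \<eta> i, j := u \<xi> j)))"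
        by (intro sum.cong) auto
      also have "\<dots> = (\<Sum>j\<in>I. \<Sum>i\<in>{i. i \<in> I \<and> i \<noteq> j}. gen (t(i := u \<eta> i, j := u \<xi> j)))"
        using \<open>finite I\<close> \<open>finite I\<close> by (rule sum.swap_restrict)
      also have "\<dots> = ?r"
        by (intro sum.cong) (auto simp: fun_upd_twist)
      finally show ?thesis .
    qed
    have "T (gen t) = (\<Sum>i\<in>I. gen (t(i := \<xi> (M i) (u \<eta> i))) - gen (t(i := \<eta> (M i) (u \<xi> i)))
        - scale c (gen (t(i := u \<zeta> i))))"
      unfolding T_def double[of \<xi> \<eta>] double[of \<eta> \<xi>] sym
      by (simp add: leibniz_gen sum_subtractf free.scale_sum_right u_def del: scale_single)
    also have "\<dots> \<in> relations"
    proof (rule free.span_sum)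
      fix i assume i: "i \<in> I"
      interpret Mi: Module.module base_ring "M i" by (rule module) fact
      define x y where "x = \<xi> (M i) (u \<eta> i)" and "y = \<eta> (M i) (u \<xi> i)"
      have u: "u \<xi> i \<in> carrier (M i)" "u \<eta> i \<in> carrier (M i)" "u \<zeta> i \<in> carrier (M i)"
        using \<xi> \<eta> \<zeta> i t by (auto simp: u_def actsD tuplesD)
      have xy: "x \<in> carrier (M i)" "y \<in> carrier (M i)"
        using \<xi> \<eta> i u by (auto simp: x_def y_def actsD)
      have "x \<ominus>\<^bsub>M i\<^esub> y = c \<odot>\<^bsub>M i\<^esub> u \<zeta> i"
        using bracket[OF i, of "t i"] i t by (simp add: x_def y_def u_def tuplesD)
      moreover have "x = (x \<ominus>\<^bsub>M i\<^esub> y) \<oplus>\<^bsub>M i\<^esub> y"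
        using xy by (simp add: a_minus_def Mi.a_assoc Mi.l_neg)
      ultimately have "gen (t(i := x)) - gen (t(i := c \<odot>\<^bsub>M i\<^esub> u \<zeta> i)) - gen (t(i := y)) \<in> relations"
        using relator_add[OF t i, of "c \<odot>\<^bsub>M i\<^esub> u \<zeta> i" y] xy u by simp
      from free.span_add[OF this relator_smult[OF t i u(3), of c]]
      show "gen (t(i := x)) - gen (t(i := y)) - scale c (gen (t(i := u \<zeta> i))) \<in> relations"
        by (simp add: algebra_simps)
    qed
    finally show ?thesis .
  qed
  then have "free.span (gen ` tuples I M) \<subseteq> {f. T f \<in> relations}"
    by (intro free.span_minimal module_hom.subspace_linear_preimage[OF T] free.subspace_span) auto
  then show ?thesis using f by (auto simp: keys_subset_eq_span[symmetric] T_def)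
qed

lemma tensor_commutator:
  assumes "finite I" "acts \<xi>" "acts \<eta>" "acts \<zeta>"
    and "\<And>i x. i \<in> I \<Longrightarrow> x \<in> carrier (M i) \<Longrightarrow>
      \<xi> (M i) (\<eta> (M i) x) \<ominus>\<^bsub>M i\<^esub> \<eta> (M i) (\<xi> (M i) x) = c \<odot>\<^bsub>M i\<^esub> \<zeta> (M i) x"
    and "x \<in> carrier (tensor I M)"
  shows "tensor_action I M \<xi> (tensor_action I M \<eta> x) \<ominus>\<^bsub>tensor I M\<^esub>
      tensor_action I M \<eta> (tensor_action I M \<xi> x) = c \<odot>\<^bsub>tensor I M\<^esub> tensor_action I M \<zeta> x"
proof -
  obtain f where f: "x = cls f" "f \<in> combos" using assms(6) by (auto simp: carrier_tensor)
  have lz: "leibniz \<xi> g \<in> combos" "leibniz \<eta> g \<in> combos" "leibniz \<zeta> g \<in> combos" if "g \<in> combos" for g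
    using assms that by (simp_all add: tensor_action_cls)
  have "cls (leibniz \<xi> (leibniz \<eta> f) - leibniz \<eta> (leibniz \<xi> f)) = cls (scale c (leibniz \<zeta> f))"
    using leibniz_commutator[OF assms(1-5) f(2)] f lz
    by (subst cls_eq_iff) (simp_all add: keys_subset_diff keys_subset_scale)
  then show ?thesis
    using assms(2-4) f lz by (simp add: tensor_action_cls minus_cls smult_cls)
qed

end

lemma linear_endo_ops:
  assumes "sl2_module M"
  shows "linear_endo M (dop M)" "linear_endo M (hop M)" "linear_endo M (zop M)"
  using assms by (simp_all add: sl2_module_def)

lemma sl2_module_tensor:
  fixes M :: "'i \<Rightarrow> ('k::comm_ring_1, 'v) sl2_rep"
  assumes "finite I" and M: "\<And>i. i \<in> I \<Longrightarrow> sl2_module (M i)"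
  shows "sl2_module (tensor I M)"
proof -
  interpret module_family I M using M by (intro module_family.intro) (simp add: sl2_module_def)
  have acts: "acts dop" "acts hop" "acts zop"
    using M by (simp_all add: acts_def linear_endo_ops)
  have one: "1 \<odot>\<^bsub>N\<^esub> x = x" if "Module.module base_ring N" "x \<in> carrier N"
    for N :: "('k, 'x, 'm) module_scheme" and x
    using module.smult_one[OF that] by simp
  have M': "hop (M i) (dop (M i) x) \<ominus>\<^bsub>M i\<^esub> dop (M i) (hop (M i) x) = 2 \<odot>\<^bsub>M i\<^esub> dop (M i) x"
      "hop (M i) (zop (M i) x) \<ominus>\<^bsub>M i\<^esub> zop (M i) (hop (M i) x) = (- 2) \<odot>\<^bsub>M i\<^esub> zop (M i) x"
      "zop (M i) (dop (M i) x) \<ominus>\<^bsub>M i\<^esub> dop (M i) (zop (M i) x) = 1 \<odot>\<^bsub>M i\<^esub> hop (M i) x"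
    if "i \<in> I" "x \<in> carrier (M i)" for i x
    using M[OF that(1)] that one[OF module[of i]] actsD(1)[OF acts(2)] by (simp_all add: sl2_module_def)
  have ops: "dop (tensor I M) = tensor_action I M dop" "hop (tensor I M) = tensor_action I M hop"
      "zop (tensor I M) = tensor_action I M zop"
    by (simp_all add: tensor_def)
  note endo = linear_endo_tensor_action[OF acts(1)] linear_endo_tensor_action[OF acts(2)]
    linear_endo_tensor_action[OF acts(3)]
  show ?thesis
    unfolding sl2_module_def ops
  proof (intro conjI ballI module_tensor endo)
    fix x assume x: "x \<in> carrier (tensor I M)"
    have "tensor_action I M hop x \<in> carrier (tensor I M)"
      using endo(2) x by (auto simp: linear_endo_def)
    note one' = one[OF module_tensor this]
    show "tensor_action I M hop (tensor_action I M dop x) \<ominus>\<^bsub>tensor I M\<^esub>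
      tensor_action I M dop (tensor_action I M hop x) = 2 \<odot>\<^bsub>tensor I M\<^esub> tensor_action I M dop x"
      by (rule tensor_commutator[OF assms(1) acts(2,1,1) M'(1) x])
    show "tensor_action I M hop (tensor_action I M zop x) \<ominus>\<^bsub>tensor I M\<^esub>
      tensor_action I M zop (tensor_action I M hop x) = (- 2) \<odot>\<^bsub>tensor I M\<^esub> tensor_action I M zop x"
      by (rule tensor_commutator[OF assms(1) acts(2,3,3) M'(2) x])
    show "tensor_action I M zop (tensor_action I M dop x) \<ominus>\<^bsub>tensor I M\<^esub>
      tensor_action I M dop (tensor_action I M zop x) = tensor_action I M hop x"
      using tensor_commutator[OF assms(1) acts(3,1,2) M'(3) x] one' by simp
  qed
qed

section \<open>Tensor products of free modules\<close>

text \<open>Identities between operators can be checked after an injective equivariant map. This spares a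
  verification of the bracket relations on polynomials: they are inherited from the tensor product.\<close>

lemma sl2_module_if_embeds:
  assumes N: "sl2_module N" and M: "Module.module base_ring M"
    and ops: "dop M \<in> carrier M \<rightarrow> carrier M" "hop M \<in> carrier M \<rightarrow> carrier M"
      "zop M \<in> carrier M \<rightarrow> carrier M"
    and \<phi>: "\<phi> \<in> carrier M \<rightarrow> carrier N" "inj_on \<phi> (carrier M)"
    and add: "\<And>x y. x \<in> carrier M \<Longrightarrow> y \<in> carrier M \<Longrightarrow> \<phi> (x \<oplus>\<^bsub>M\<^esub> y) = \<phi> x \<oplus>\<^bsub>N\<^esub> \<phi> y"
    and smult: "\<And>c x. x \<in> carrier M \<Longrightarrow> \<phi> (c \<odot>\<^bsub>M\<^esub> x) = c \<odot>\<^bsub>N\<^esub> \<phi> x"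
    and equivariant: "\<And>x. x \<in> carrier M \<Longrightarrow> \<phi> (dop M x) = dop N (\<phi> x)"
      "\<And>x. x \<in> carrier M \<Longrightarrow> \<phi> (hop M x) = hop N (\<phi> x)"
      "\<And>x. x \<in> carrier M \<Longrightarrow> \<phi> (zop M x) = zop N (\<phi> x)"
  shows "sl2_module M"
proof -
  interpret M: Module.module base_ring M by fact
  interpret N: Module.module base_ring N using N by (simp add: sl2_module_def)
  have closed: "dop M x \<in> carrier M" "hop M x \<in> carrier M" "zop M x \<in> carrier M" "\<phi> x \<in> carrier N"
      "c \<odot>\<^bsub>M\<^esub> x \<in> carrier M"
    if "x \<in> carrier M" for x c using ops \<phi>(1) that by auto
  have diff: "\<phi> (x \<ominus>\<^bsub>M\<^esub> y) = \<phi> x \<ominus>\<^bsub>N\<^esub> \<phi> y" if xy: "x \<in> carrier M" "y \<in> carrier M" for x y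
  proof -
    have "x = (x \<ominus>\<^bsub>M\<^esub> y) \<oplus>\<^bsub>M\<^esub> y" using xy by (simp add: a_minus_def M.a_assoc M.l_neg)
    then have "\<phi> x = \<phi> (x \<ominus>\<^bsub>M\<^esub> y) \<oplus>\<^bsub>N\<^esub> \<phi> y" using add xy M.minus_closed by metis
    then show ?thesis using xy by (simp add: a_minus_def N.a_assoc N.r_neg closed)
  qed
  note Nops = N[unfolded sl2_module_def linear_endo_def]
  have eqI: "x = y" if "x \<in> carrier M" "y \<in> carrier M" "\<phi> x = \<phi> y" for x y
    using \<phi>(2) that by (auto simp: inj_on_def)
  show ?thesis
    unfolding sl2_module_def linear_endo_def
    using Nops by (intro conjI ballI allI ops M; intro eqI)
      (simp_all add: closed add smult diff equivariant)
qed

text \<open>On a convolution algebra, scaling is multiplication by a constant, which makes the ring product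
  bilinear.\<close>

lemma scale_eq_mult:
  "scale c f = Poly_Mapping.single 0 c * (f :: 'a::cancel_comm_monoid_add \<Rightarrow>\<^sub>0 'k::comm_ring_1)"
proof -
  have "f \<in> free.span (gen ` UNIV)" by (simp flip: keys_subset_eq_span)
  then show ?thesis
  proof (induction rule: free.span_induct_alt)
    case (step d x y)
    then show ?case by (auto simp: distrib_left free.scale_right_distrib mult_single)
  qed simp
qed

lemma scale_mult_left:
  "scale c f * g = scale c (f * g :: 'a::cancel_comm_monoid_add \<Rightarrow>\<^sub>0 'k::comm_ring_1)"
  by (simp add: scale_eq_mult mult.assoc)

lemma scale_mult_right:
  "f * scale c g = scale c (f * g :: 'a::cancel_comm_monoid_add \<Rightarrow>\<^sub>0 'k::comm_ring_1)"
  by (simp add: scale_eq_mult ac_simps)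

lemma prod_gen:
  "finite I \<Longrightarrow>
    (\<Prod>i\<in>I. gen (f i)) = (gen (\<Sum>i\<in>I. f i) :: 'a::cancel_comm_monoid_add \<Rightarrow>\<^sub>0 'k::comm_ring_1)"
  by (induction I rule: finite_induct) (auto simp: mult_single)

lemma lookup_sum_single:
  "finite I \<Longrightarrow> Poly_Mapping.lookup (\<Sum>i\<in>I. Poly_Mapping.single i (k i)) j = (if j \<in> I then k j else 0)"
  by (simp add: lookup_sum lookup_single when_def)

text \<open>Exponent vectors of monomials in the variables \<open>I\<close> that correspond to tuples of basis vectors
  indexed by the sets \<open>S i\<close>.\<close>

definition box :: "'i set \<Rightarrow> ('i \<Rightarrow> nat set) \<Rightarrow> ('i \<Rightarrow>\<^sub>0 nat) set"
  where "box I S = {m. Poly_Mapping.keys m \<subseteq> I \<and> (\<forall>i\<in>I. Poly_Mapping.lookup m i \<in> S i)}"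

lemma update_in_box:
  assumes "m \<in> box I S" "i \<in> I" "k \<in> S i"
  shows "Poly_Mapping.update i k m \<in> box I S"
  using assms by (auto simp: box_def keys_update lookup_update)

text \<open>The linear map from one-variable exponents to polynomials that replaces the \<open>i\<close>-th exponent of the
  monomial \<open>m\<close>.\<close>

definition slot :: "('i \<Rightarrow>\<^sub>0 nat) \<Rightarrow> 'i \<Rightarrow> (nat \<Rightarrow>\<^sub>0 'k) \<Rightarrow> (('i \<Rightarrow>\<^sub>0 nat) \<Rightarrow>\<^sub>0 'k::comm_ring_1)"
  where "slot m i = lin_extend (\<lambda>k. gen (Poly_Mapping.update i k m))"

text \<open>The operator on polynomials given by the Leibniz rule on monomials: \<open>A i\<close> acts on the \<open>i\<close>-th
  exponent and the results are summed. The operators of the twisted representation have this form.\<close>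

definition componentwise ::
    "'i set \<Rightarrow> ('i \<Rightarrow> (nat \<Rightarrow>\<^sub>0 'k) \<Rightarrow> (nat \<Rightarrow>\<^sub>0 'k)) \<Rightarrow>
      (('i \<Rightarrow>\<^sub>0 nat) \<Rightarrow>\<^sub>0 'k) \<Rightarrow> (('i \<Rightarrow>\<^sub>0 nat) \<Rightarrow>\<^sub>0 'k::comm_ring_1)"
  where "componentwise I A =
    lin_extend (\<lambda>m. \<Sum>i\<in>I. slot m i (A i (gen (Poly_Mapping.lookup m i))))"

lemma linear_map_slot: "linear_map (slot m i)"
  unfolding slot_def by (rule linear_map_lin_extend)

lemma linear_map_componentwise: "linear_map (componentwise I A)"
  unfolding componentwise_def by (rule linear_map_lin_extend)

lemma keys_componentwise:
  assumes A: "\<And>i x. i \<in> I \<Longrightarrow> Poly_Mapping.keys x \<subseteq> S i \<Longrightarrow> Poly_Mapping.keys (A i x) \<subseteq> S i"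
    and f: "Poly_Mapping.keys f \<subseteq> box I S"
  shows "Poly_Mapping.keys (componentwise I A f) \<subseteq> box I S"
  unfolding componentwise_def
proof (rule lin_extend_keys_subset[OF _ f])
  fix m assume m: "m \<in> box I S"
  have "Poly_Mapping.keys (slot m i (A i (gen (Poly_Mapping.lookup m i)))) \<subseteq> box I S"
    if i: "i \<in> I" for i
    unfolding slot_def
    by (rule lin_extend_keys_subset[where B = "S i"])
      (use m i A[of i "gen (Poly_Mapping.lookup m i)"] in \<open>simp_all add: update_in_box, simp add: box_def\<close>)
  then show "Poly_Mapping.keys (\<Sum>i\<in>I. slot m i (A i (gen (Poly_Mapping.lookup m i)))) \<subseteq> box I S"
    by (rule keys_subset_sum)
qed

locale monomial_family =
  fixes I :: "'i set" and S :: "'i \<Rightarrow> nat set"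
    and M :: "'i \<Rightarrow> ('k::comm_ring_1, nat \<Rightarrow>\<^sub>0 'k) sl2_rep"
  assumes finite: "finite I"
    and sl2_module: "i \<in> I \<Longrightarrow> sl2_module (M i)"
    and inside_free: "i \<in> I \<Longrightarrow> inside_free (M i)"
    and carrier: "i \<in> I \<Longrightarrow> carrier (M i) = {f. Poly_Mapping.keys f \<subseteq> S i}"
begin

sublocale module_family I M
  by (rule module_family.intro) (use sl2_module in \<open>simp add: sl2_module_def\<close>)

lemma M_simps [simp]:
  assumes "i \<in> I"
  shows "\<zero>\<^bsub>M i\<^esub> = 0" "x \<oplus>\<^bsub>M i\<^esub> y = x + y" "c \<odot>\<^bsub>M i\<^esub> x = scale c x"
  using inside_free[OF assms] by (simp_all add: inside_free_def)

definition basis_tuple :: "('i \<Rightarrow>\<^sub>0 nat) \<Rightarrow> 'i \<Rightarrow> (nat \<Rightarrow>\<^sub>0 'k)"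
  where "basis_tuple m = (\<lambda>i\<in>I. gen (Poly_Mapping.lookup m i))"

definition expand :: "(('i \<Rightarrow>\<^sub>0 nat) \<Rightarrow>\<^sub>0 'k) \<Rightarrow> (('i \<Rightarrow> (nat \<Rightarrow>\<^sub>0 'k)) \<Rightarrow>\<^sub>0 'k)"
  where "expand = lin_extend (\<lambda>m. gen (basis_tuple m))"

lemma expand_gen: "expand (gen m) = gen (basis_tuple m)"
  by (simp add: expand_def)

text \<open>The substitution of the \<open>i\<close>-th variable: \<open>w\<^sub>m\<close> goes to the power \<open>m\<close> of that variable.\<close>

definition in_variable :: "'i \<Rightarrow> (nat \<Rightarrow>\<^sub>0 'k) \<Rightarrow> (('i \<Rightarrow>\<^sub>0 nat) \<Rightarrow>\<^sub>0 'k)"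
  where "in_variable i = lin_extend (\<lambda>k. gen (Poly_Mapping.single i k))"

definition multiply :: "(('i \<Rightarrow> (nat \<Rightarrow>\<^sub>0 'k)) \<Rightarrow>\<^sub>0 'k) \<Rightarrow> (('i \<Rightarrow>\<^sub>0 nat) \<Rightarrow>\<^sub>0 'k)"
  where "multiply = lin_extend (\<lambda>t. \<Prod>i\<in>I. in_variable i (t i))"

lemma linear_map_expand: "linear_map expand"
  unfolding expand_def by (rule linear_map_lin_extend)

lemma linear_map_in_variable: "linear_map (in_variable i)"
  unfolding in_variable_def by (rule linear_map_lin_extend)

lemma linear_map_multiply: "linear_map multiply"
  unfolding multiply_def by (rule linear_map_lin_extend)

lemma basis_tuple: "m \<in> box I S \<Longrightarrow> basis_tuple m \<in> tuples I M"
  by (auto simp: basis_tuple_def tuples_def box_def carrier)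

lemma keys_expand: "Poly_Mapping.keys f \<subseteq> box I S \<Longrightarrow> Poly_Mapping.keys (expand f) \<subseteq> tuples I M"
  unfolding expand_def by (rule lin_extend_keys_subset) (auto simp: basis_tuple)

text \<open>A product of linear images of the entries is multilinear in the entries.\<close>

lemma multiply_relations: "f \<in> relations \<Longrightarrow> multiply f = 0"
proof (induction rule: relations_induct)
  case subspace
  show ?case by (rule module_hom.subspace_kernel[OF linear_map_multiply])
next
  case (add t i x y)
  have "multiply (gen (t(i := z))) = in_variable i z * (\<Prod>j\<in>I - {i}. in_variable j (t j))" for z
    using add finite by (simp add: multiply_def prod.remove[of I i])
  then show ?case
    using add by (simp add: linear_map_diff[OF linear_map_multiply]
        linear_map_add[OF linear_map_in_variable] distrib_right)
next
  case (smult t i c x)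
  have "multiply (gen (t(i := z))) = in_variable i z * (\<Prod>j\<in>I - {i}. in_variable j (t j))" for z
    using smult finite by (simp add: multiply_def prod.remove[of I i])
  then show ?case
    using smult by (simp add: linear_map_diff[OF linear_map_multiply]
        linear_map_scale[OF linear_map_multiply]
        linear_map_scale[OF linear_map_in_variable] scale_mult_left del: scale_single)
qed

text \<open>Multiplying out is a left inverse of the map from monomials to tuples of basis vectors. This is
  where the linear independence of the pure tensors of basis vectors comes from.\<close>

lemma multiply_expand:
  assumes "Poly_Mapping.keys f \<subseteq> box I S"
  shows "multiply (expand f) = f"
proof -
  have "multiply (expand (gen m)) = gen m" if "m \<in> box I S" for m
  proof -
    have "(\<Sum>i\<in>I. Poly_Mapping.single i (Poly_Mapping.lookup m i)) = m"
      using that finite by (intro poly_mapping_eqI) (auto simp: lookup_sum_single box_def in_keys_iff)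
    then show ?thesis
      using finite by (simp add: multiply_def expand_def in_variable_def basis_tuple_def prod_gen)
  qed
  then show ?thesis
    using linear_map_eqI[OF module_hom_compose[OF linear_map_expand linear_map_multiply]
      free.module_hom_ident _ assms] by simp
qed

text \<open>Modulo the relations, \<open>t(i := x)\<close> depends linearly on \<open>x\<close>, so a comparison with a linear map can be
  checked on the basis of the \<open>i\<close>-th factor. The subspace \<open>W\<close> serves two purposes: with \<open>W\<close> equal to
  the relations the lemma proves a congruence of tensors, and with \<open>G = 0\<close> it proves that a tensor
  lies in a larger subspace.\<close>

lemma slot_induct:
  assumes "free.subspace W" "relations \<subseteq> W" and G: "linear_map G"
    and t: "t \<in> tuples I M" and i: "i \<in> I" and x: "x \<in> carrier (M i)"
    and gen: "\<And>k. k \<in> S i \<Longrightarrow> gen (t(i := gen k)) - G (gen k) \<in> W"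
  shows "gen (t(i := x)) - G x \<in> W"
proof -
  let ?V = "{x. x \<in> carrier (M i) \<and> gen (t(i := x)) - G x \<in> W}"
  have add: "x + y \<in> ?V" if "x \<in> ?V" "y \<in> ?V" for x y
  proof -
    have "gen (t(i := x + y)) - gen (t(i := x)) - gen (t(i := y)) \<in> W"
      using relator_add[OF t i, of x y] that i assms(2) by auto
    moreover have "(gen (t(i := x)) - G x) + (gen (t(i := y)) - G y) \<in> W"
      using free.subspace_add[OF assms(1)] that by simp
    ultimately have "gen (t(i := x + y)) - gen (t(i := x)) - gen (t(i := y)) +
        ((gen (t(i := x)) - G x) + (gen (t(i := y)) - G y)) \<in> W"
      by (rule free.subspace_add[OF assms(1)])
    then show ?thesis
      using that i by (simp add: carrier keys_subset_add linear_map_add[OF G] algebra_simps)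
  qed
  have smult: "scale c x \<in> ?V" if "x \<in> ?V" for c x
  proof -
    have "gen (t(i := scale c x)) - scale c (gen (t(i := x))) \<in> W"
      using relator_smult[OF t i, of x c] that i assms(2) by auto
    moreover have "scale c (gen (t(i := x)) - G x) \<in> W"
      using free.subspace_scale[OF assms(1)] that by blast
    ultimately have "gen (t(i := scale c x)) - scale c (gen (t(i := x))) +
        scale c (gen (t(i := x)) - G x) \<in> W"
      by (rule free.subspace_add[OF assms(1)])
    then show ?thesis
      using that i by (simp add: carrier keys_subset_scale linear_map_scale[OF G]
          free.scale_right_diff_distrib del: scale_single)
  qed
  have "0 \<in> ?V"
  proof -
    \<comment> \<open>A tuple with a zero entry is congruent to zero by the relator for the scalar \<open>0\<close>.\<close>
    have "gen (t(i := scale 0 0)) - scale 0 (gen (t(i := 0))) \<in> W"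
      using relator_smult[OF t i, of 0 0] i assms(2) by (auto simp: carrier)
    then show ?thesis using i module_hom.zero[OF G] by (simp add: carrier)
  qed
  then have "free.subspace ?V"
    using add smult by (simp add: free.subspace_def)
  moreover have "gen ` S i \<subseteq> ?V"
    using gen i by (auto simp: carrier)
  ultimately have "free.span (gen ` S i) \<subseteq> ?V"
    by (intro free.span_minimal)
  then show ?thesis
    using x i by (auto simp: carrier keys_subset_eq_span)
qed

lemma gen_upd_basis_tuple:
  assumes "m \<in> box I S" "i \<in> I" "x \<in> carrier (M i)"
  shows "gen ((basis_tuple m)(i := x)) - expand (slot m i x) \<in> relations"
proof (rule slot_induct[OF free.subspace_span order_refl _ basis_tuple[OF assms(1)] assms(2,3)])
  show "linear_map (\<lambda>x. expand (slot m i x))"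
    using module_hom_compose[OF linear_map_slot linear_map_expand] by (simp add: o_def)
next
  fix k
  have "basis_tuple (Poly_Mapping.update i k m) = (basis_tuple m)(i := gen k)"
    using assms(2) by (auto simp: basis_tuple_def lookup_update)
  then show "gen ((basis_tuple m)(i := gen k)) - expand (slot m i (gen k)) \<in> relations"
    by (simp add: expand_def slot_def free.span_zero)
qed

lemma leibniz_expand:
  assumes \<xi>: "acts \<xi>" and f: "Poly_Mapping.keys f \<subseteq> box I S"
  shows "leibniz \<xi> (expand f) - expand (componentwise I (\<lambda>i. \<xi> (M i)) f) \<in> relations"
proof -
  define T where "T f = leibniz \<xi> (expand f) - expand (componentwise I (\<lambda>i. \<xi> (M i)) f)" for f
  note lin = linear_map_leibniz linear_map_expand linear_map_componentwise
  have T: "linear_map T"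
    by (rule linear_mapI)
      (simp_all add: T_def lin[THEN linear_map_add] lin[THEN linear_map_scale]
        free.scale_right_diff_distrib)
  have "T (gen m) \<in> relations" if m: "m \<in> box I S" for m
  proof -
    have "T (gen m) = (\<Sum>i\<in>I. gen ((basis_tuple m)(i := \<xi> (M i) (gen (Poly_Mapping.lookup m i))))
        - expand (slot m i (\<xi> (M i) (gen (Poly_Mapping.lookup m i)))))"
      by (simp add: T_def expand_gen leibniz_gen componentwise_def basis_tuple_def sum_subtractf
          linear_map_sum[OF linear_map_expand])
    also have "\<dots> \<in> relations"
      using m by (intro free.span_sum gen_upd_basis_tuple actsD[OF \<xi>]) (auto simp: carrier box_def)
    finally show ?thesis .
  qed
  then have "free.span (gen ` box I S) \<subseteq> {f. T f \<in> relations}"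
    by (intro free.span_minimal module_hom.subspace_linear_preimage[OF T] free.subspace_span) auto
  then show ?thesis using f by (auto simp: keys_subset_eq_span[symmetric] T_def)
qed

text \<open>One entry of the tuple after the other is expanded in the basis: the induction is on the set of
  entries that are not yet basis vectors.\<close>

lemma pure_tensor_expansion:
  assumes "t \<in> tuples I M"
  shows "\<exists>r. Poly_Mapping.keys r \<subseteq> box I S \<and> gen t - expand r \<in> relations"
proof -
  let ?K = "{r. Poly_Mapping.keys r \<subseteq> box I S}"
  define W where "W = free.span (relations \<union> expand ` ?K)"
  have W: "free.subspace W" "relations \<subseteq> W" "expand ` ?K \<subseteq> W"
    using free.span_superset[of "relations \<union> expand ` ?K"] by (simp_all add: W_def)
  have "gen t \<in> W"
    if "finite J" "J \<subseteq> I" "t \<in> tuples I M" "\<forall>i\<in>I - J. \<exists>k\<in>S i. t i = gen k" for t J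
    using that
  proof (induction J arbitrary: t rule: finite_induct)
    case empty
    then obtain k where k: "\<forall>i\<in>I. k i \<in> S i \<and> t i = gen (k i)" by (metis Diff_empty)
    define m where "m = (\<Sum>i\<in>I. Poly_Mapping.single i (k i))"
    have lookup_m: "Poly_Mapping.lookup m j = (if j \<in> I then k j else 0)" for j
      using finite by (simp add: m_def lookup_sum_single)
    then have "m \<in> box I S" using k by (auto simp: box_def in_keys_iff split: if_splits)
    moreover have "basis_tuple m = t"
      using k empty(2) by (auto simp: basis_tuple_def lookup_m tuples_def fun_eq_iff PiE_def extensional_def)
    moreover have "expand (gen m) \<in> W"
      using W(3) \<open>m \<in> box I S\<close> by (simp add: image_subset_iff)
    ultimately show ?case by (simp add: expand_gen)
  next
    case (insert j J)
    have "gen (t(j := t j)) - 0 \<in> W"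
    proof (rule slot_induct[OF W(1,2) free_pair.module_hom_zero insert.prems(2)])
      show "j \<in> I" "t j \<in> carrier (M j)" using insert.prems by (auto simp: tuplesD)
      fix k assume "k \<in> S j"
      then have "gen (t(j := gen k)) \<in> W"
        using insert.prems \<open>j \<in> I\<close> by (intro insert.IH tuples_upd) (auto simp: carrier)
      then show "gen (t(j := gen k)) - 0 \<in> W" by simp
    qed
    then show ?case by simp
  qed
  from this[of I t] have "gen t \<in> W" using finite assms by simp
  moreover have "free.span (expand ` ?K) = expand ` ?K"
    using module_hom.subspace_image[OF linear_map_expand subspace_keys_subset] by simp
  ultimately obtain f r where "gen t = f + expand r" "f \<in> relations" "r \<in> ?K"
    by (auto simp: W_def free.span_Un free.span_span)
  then show ?thesis by (intro exI[of _ r]) simp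
qed

lemma expansion:
  assumes "f \<in> combos"
  shows "\<exists>r. Poly_Mapping.keys r \<subseteq> box I S \<and> f - expand r \<in> relations"
  using assms unfolding keys_subset_eq_span
proof (induction rule: free.span_induct_alt)
  case base
  show ?case using module_hom.zero[OF linear_map_expand] free.span_zero by (intro exI[of _ 0]) simp
next
  case (step c t f)
  obtain r where r: "Poly_Mapping.keys r \<subseteq> box I S" "t - expand r \<in> relations"
    using pure_tensor_expansion step.hyps by auto
  obtain s where s: "Poly_Mapping.keys s \<subseteq> box I S" "f - expand s \<in> relations"
    using step.IH by blast
  have "scale c (t - expand r) + (f - expand s) \<in> relations"
    using r s by (intro free.span_add free.span_scale)
  also have "scale c (t - expand r) + (f - expand s) = scale c t + f - expand (scale c r + s)"
    by (simp add: linear_map_add[OF linear_map_expand] linear_map_scale[OF linear_map_expand]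
        free.scale_right_diff_distrib)
  finally show ?case
    using r s by (intro exI[of _ "scale c r + s"]) (simp add: keys_subset_add keys_subset_scale)
qed

text \<open>A monomial goes to the pure tensor of the basis vectors given by its exponents. This map is
  surjective because tensors can be expanded, injective because multiplying out inverts it, and
  equivariant because an operator acting on a single exponent corresponds to that operator acting on
  a single tensor factor.\<close>

theorem sl2_iso_tensor:
  fixes R :: "('k, ('i \<Rightarrow>\<^sub>0 nat) \<Rightarrow>\<^sub>0 'k) sl2_rep"
  assumes R: "inside_free R" "carrier R = {f. Poly_Mapping.keys f \<subseteq> box I S}"
    and ops: "\<And>f. f \<in> carrier R \<Longrightarrow> dop R f = componentwise I (\<lambda>i. dop (M i)) f"
      "\<And>f. f \<in> carrier R \<Longrightarrow> hop R f = componentwise I (\<lambda>i. hop (M i)) f"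
      "\<And>f. f \<in> carrier R \<Longrightarrow> zop R f = componentwise I (\<lambda>i. zop (M i)) f"
  shows "R \<cong>\<^sub>s\<^sub>l tensor I M"
proof -
  define \<phi> where "\<phi> f = cls (expand f)" for f
  have R_simps: "\<zero>\<^bsub>R\<^esub> = 0" "f \<oplus>\<^bsub>R\<^esub> g = f + g" "c \<odot>\<^bsub>R\<^esub> f = scale c f" for f g c
    using R(1) by (simp_all add: inside_free_def)
  have acts: "acts dop" "acts hop" "acts zop"
    using sl2_module by (simp_all add: acts_def linear_endo_ops)
  have tensor_ops: "dop (tensor I M) = tensor_action I M dop"
      "hop (tensor I M) = tensor_action I M hop" "zop (tensor I M) = tensor_action I M zop"
    by (simp_all add: tensor_def)
  have closed: "componentwise I (\<lambda>i. \<xi> (M i)) f \<in> carrier R" if "acts \<xi>" "f \<in> carrier R" for \<xi> f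
    using that actsD(1)[OF that(1)] keys_componentwise[of I S "\<lambda>i. \<xi> (M i)" f] R(2)
    by (simp add: carrier)
  have equivariant: "\<phi> (componentwise I (\<lambda>i. \<xi> (M i)) f) = tensor_action I M \<xi> (\<phi> f)"
    if \<xi>: "acts \<xi>" and f: "f \<in> carrier R" for \<xi> f
  proof -
    have "cls (leibniz \<xi> (expand f)) = cls (expand (componentwise I (\<lambda>i. \<xi> (M i)) f))"
      using leibniz_expand[OF \<xi>] f closed[OF \<xi> f] \<xi>
      by (subst cls_eq_iff) (simp_all add: R keys_expand tensor_action_cls(1))
    then show ?thesis
      using f \<xi> by (simp add: \<phi>_def tensor_action_cls R keys_expand)
  qed
  have inj: "inj_on \<phi> (carrier R)"
  proof (rule inj_onI)
    fix f g assume fg: "f \<in> carrier R" "g \<in> carrier R" and "\<phi> f = \<phi> g"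
    then have "expand f - expand g \<in> relations"
      by (simp add: \<phi>_def R keys_expand flip: cls_eq_iff)
    from multiply_relations[OF this] show "f = g"
      using fg by (simp add: linear_map_diff[OF linear_map_multiply] multiply_expand R)
  qed
  have bij: "bij_betw \<phi> (carrier R) (carrier (tensor I M))"
    unfolding bij_betw_def
  proof (intro conjI inj antisym subsetI)
    fix C assume "C \<in> carrier (tensor I M)"
    then obtain f where f: "C = cls f" "f \<in> combos" by (auto simp: carrier_tensor)
    then obtain r where "Poly_Mapping.keys r \<subseteq> box I S" "f - expand r \<in> relations"
      using expansion by blast
    then have "r \<in> carrier R" "C = \<phi> r"
      using f cls_eq_iff[of f "expand r"] by (simp_all add: R \<phi>_def keys_expand)
    then show "C \<in> \<phi> ` carrier R" by blast
  qed (auto simp: \<phi>_def R carrier_tensor keys_expand)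
  have add: "\<phi> (f \<oplus>\<^bsub>R\<^esub> g) = \<phi> f \<oplus>\<^bsub>tensor I M\<^esub> \<phi> g" if "f \<in> carrier R" "g \<in> carrier R" for f g
    using that by (simp add: \<phi>_def R R_simps add_cls keys_expand linear_map_add[OF linear_map_expand])
  have smult: "\<phi> (c \<odot>\<^bsub>R\<^esub> f) = c \<odot>\<^bsub>tensor I M\<^esub> \<phi> f" if "f \<in> carrier R" for c f
    using that by (simp add: \<phi>_def R R_simps smult_cls keys_expand linear_map_scale[OF linear_map_expand])
  have equi: "\<phi> (dop R f) = dop (tensor I M) (\<phi> f)" "\<phi> (hop R f) = hop (tensor I M) (\<phi> f)"
    "\<phi> (zop R f) = zop (tensor I M) (\<phi> f)" if "f \<in> carrier R" for f
    using that by (simp_all add: ops tensor_ops equivariant acts)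
  have "sl2_module (tensor I M)" using finite sl2_module by (rule sl2_module_tensor)
  moreover from this have "sl2_module R"
    by (rule sl2_module_if_embeds[of _ _ \<phi>])
      (use R(1) bij inj add smult equi in
        \<open>auto simp: ops closed acts module_of_subspace bij_betw_def\<close>)
  ultimately show ?thesis
    unfolding sl2_iso_def using bij add smult equi by blast
qed

end

section \<open>The modules \<open>\<nabla>(k)\<close>\<close>

lemma minus_inside_free:
  assumes "inside_free M" "x \<in> carrier M" "y \<in> carrier M"
  shows "x \<ominus>\<^bsub>M\<^esub> y = x - y"
  using assms by (simp add: a_minus_def a_inv_of_subspace) (simp add: inside_free_def)

definition nabla_on :: "int \<Rightarrow> nat set \<Rightarrow> ('k::comm_ring_1, nat \<Rightarrow>\<^sub>0 'k) sl2_rep"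
  where "nabla_on k S = (nabla k)\<lparr>carrier := {f. Poly_Mapping.keys f \<subseteq> S}\<rparr>"

text \<open>The span of the basis vectors \<open>w\<^sub>k\<^sub>,\<^sub>m\<close> with \<open>m \<in> S\<close> is then closed under the action: \<open>d\<close> annihilates
  \<open>w\<^sub>k\<^sub>,\<^sub>m\<close> exactly where \<open>Suc m\<close> may be missing.\<close>

definition stable :: "int \<Rightarrow> nat set \<Rightarrow> bool"
  where "stable k S \<longleftrightarrow> (\<forall>m\<in>S. int m + k = 0 \<or> Suc m \<in> S) \<and> (\<forall>m. Suc m \<in> S \<longrightarrow> m \<in> S)"

lemma nabla_ops_single:
  "dop (nabla k) (Poly_Mapping.single m c) = Poly_Mapping.single (Suc m) (c * of_int (int m + k))"
  "hop (nabla k) (Poly_Mapping.single m c) = Poly_Mapping.single m (c * of_int (k + 2 * int m))"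
  "zop (nabla k) (Poly_Mapping.single m c) = Poly_Mapping.single (m - 1) (c * of_nat m)"
  by (simp_all add: nabla_def split: nat.split)

lemmas nabla_ops_gen = nabla_ops_single[where c = 1, unfolded mult_1_left]

lemma linear_map_nabla_ops:
  "linear_map (dop (nabla k))" "linear_map (hop (nabla k))" "linear_map (zop (nabla k))"
  by (simp_all add: nabla_def linear_map_lin_extend)

lemma nabla_on_simps [simp]:
  "carrier (nabla_on k S) = {f. Poly_Mapping.keys f \<subseteq> S}" "ring.zero (nabla_on k S) = 0"
  "add (nabla_on k S) = (+)" "module.smult (nabla_on k S) = scale"
  "dop (nabla_on k S) = dop (nabla k)" "hop (nabla_on k S) = hop (nabla k)"
  "zop (nabla_on k S) = zop (nabla k)"
  by (simp_all add: nabla_on_def) (simp_all add: nabla_def)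

lemma inside_free_nabla_on: "inside_free (nabla_on k S)"
  by (simp add: inside_free_def subspace_keys_subset)

lemma nabla_ops_keys:
  fixes f :: "nat \<Rightarrow>\<^sub>0 'b::comm_ring_1"
  assumes "stable k S" "Poly_Mapping.keys f \<subseteq> S"
  shows "Poly_Mapping.keys (dop (nabla k) f) \<subseteq> S" "Poly_Mapping.keys (hop (nabla k) f) \<subseteq> S"
    "Poly_Mapping.keys (zop (nabla k) f) \<subseteq> S"
proof -
  have up: "int m + k = 0 \<or> Suc m \<in> S" if "m \<in> S" for m
    using assms(1) that by (auto simp: stable_def)
  have down: "m - 1 \<in> S" if "m \<in> S" for m
    using assms(1) that by (cases m) (auto simp: stable_def)
  have "Poly_Mapping.keys (dop (nabla k) (gen m :: nat \<Rightarrow>\<^sub>0 'b)) \<subseteq> S" if "m \<in> S" for m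
    using up[OF that] by (cases "int m + k = 0") (simp_all add: nabla_ops_gen del: of_int_add)
  then show "Poly_Mapping.keys (dop (nabla k) f) \<subseteq> S"
    using linear_map_keys_subset[OF linear_map_nabla_ops(1) _ assms(2)] by blast
  show "Poly_Mapping.keys (hop (nabla k) f) \<subseteq> S"
    by (rule linear_map_keys_subset[OF linear_map_nabla_ops(2) _ assms(2)])
      (auto simp: nabla_ops_gen)
  show "Poly_Mapping.keys (zop (nabla k) f) \<subseteq> S"
    by (rule linear_map_keys_subset[OF linear_map_nabla_ops(3) _ assms(2)])
      (use down in \<open>auto simp: nabla_ops_gen\<close>)
qed

lemma linear_map_commutator:
  assumes "linear_map F" "linear_map G"
  shows "linear_map (\<lambda>f. F (G f) - G (F f))"
  by (rule linear_mapI)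
    (simp_all add: assms[THEN linear_map_add] assms[THEN linear_map_scale]
      free.scale_right_diff_distrib)

lemma nabla_brackets:
  fixes f :: "nat \<Rightarrow>\<^sub>0 'k::comm_ring_1"
  shows "hop (nabla k) (dop (nabla k) f) - dop (nabla k) (hop (nabla k) f) = scale 2 (dop (nabla k) f)"
    (is ?hd)
    and "hop (nabla k) (zop (nabla k) f) - zop (nabla k) (hop (nabla k) f) =
      scale (- 2) (zop (nabla k) f)" (is ?hz)
    and "zop (nabla k) (dop (nabla k) f) - dop (nabla k) (zop (nabla k) f) = hop (nabla k) f" (is ?zd)
proof -
  note commutator = linear_map_commutator[OF linear_map_nabla_ops(2,1)]
    linear_map_commutator[OF linear_map_nabla_ops(2,3)] linear_map_commutator[OF linear_map_nabla_ops(3,1)]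
  have "(\<lambda>f. hop (nabla k) (dop (nabla k) f) - dop (nabla k) (hop (nabla k) f)) =
      (\<lambda>f. scale 2 (dop (nabla k) f :: nat \<Rightarrow>\<^sub>0 'k))"
  proof (rule linear_map_ext[OF commutator(1) free_pair.module_hom_scale[OF linear_map_nabla_ops(1)]])
    fix m
    have "of_int (int m + k) * of_int (k + 2 * int (Suc m)) -
        of_int (k + 2 * int m) * of_int (int m + k) = (2 * of_int (int m + k) :: 'k)"
      by (simp add: algebra_simps)
    then show "hop (nabla k) (dop (nabla k) (gen m)) - dop (nabla k) (hop (nabla k) (gen m)) =
        scale 2 (dop (nabla k) (gen m :: nat \<Rightarrow>\<^sub>0 'k))"
      by (simp add: nabla_ops_single flip: single_diff del: of_int_add of_int_mult)
  qed
  then show ?hd by (rule fun_cong)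
  have "(\<lambda>f. hop (nabla k) (zop (nabla k) f) - zop (nabla k) (hop (nabla k) f)) =
      (\<lambda>f. scale (- 2) (zop (nabla k) f :: nat \<Rightarrow>\<^sub>0 'k))"
  proof (rule linear_map_ext[OF commutator(2) free_pair.module_hom_scale[OF linear_map_nabla_ops(3)]])
    fix m
    have "of_nat m * of_int (k + 2 * int (m - 1)) - of_int (k + 2 * int m) * of_nat m =
        (- 2 * of_nat m :: 'k)"
      by (cases m) (simp_all add: algebra_simps)
    then show "hop (nabla k) (zop (nabla k) (gen m)) - zop (nabla k) (hop (nabla k) (gen m)) =
        scale (- 2) (zop (nabla k) (gen m :: nat \<Rightarrow>\<^sub>0 'k))"
      by (simp only: nabla_ops_single scale_single mult_1_left flip: single_diff)
  qed
  then show ?hz by (rule fun_cong)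
  have "(\<lambda>f. zop (nabla k) (dop (nabla k) f) - dop (nabla k) (zop (nabla k) f)) =
      (hop (nabla k) :: (nat \<Rightarrow>\<^sub>0 'k) \<Rightarrow> _)"
  proof (rule linear_map_ext[OF commutator(3) linear_map_nabla_ops(2)])
    fix m
    show "zop (nabla k) (dop (nabla k) (gen m)) - dop (nabla k) (zop (nabla k) (gen m)) =
        hop (nabla k) (gen m :: nat \<Rightarrow>\<^sub>0 'k)"
    proof (cases m)
      case 0
      then show ?thesis by (simp add: nabla_ops_single module_hom.zero[OF linear_map_nabla_ops(1)] del: single_one)
    next
      case (Suc j)
      have "of_int (int (Suc j) + k) * of_nat (Suc (Suc j)) - of_nat (Suc j) * of_int (int j + k) =
          (of_int (k + 2 * int (Suc j)) :: 'k)"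
        by (simp add: algebra_simps)
      then show ?thesis
        by (simp only: Suc nabla_ops_single scale_single mult_1_left diff_Suc_1 flip: single_diff)
    qed
  qed
  then show ?zd by (rule fun_cong)
qed

text \<open>The same argument covers \<open>\<nabla>(k)\<close> and, for \<open>k \<le> 0\<close>, its submodule \<open>L\<^sub>k\<close>, since both are spanned
  by a stable set of basis vectors.\<close>

lemma sl2_module_nabla_on:
  assumes "stable k S"
  shows "sl2_module (nabla_on k S)"
  unfolding sl2_module_def linear_endo_def
  by (intro conjI ballI allI funcsetI module_of_subspace inside_free_nabla_on)
    (simp_all add: minus_inside_free inside_free_nabla_on nabla_ops_keys[OF assms] nabla_brackets
      linear_map_nabla_ops[THEN linear_map_add] linear_map_nabla_ops[THEN linear_map_scale])

lemma nabla_eq_nabla_on: "nabla k = nabla_on k UNIV"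
  unfolding nabla_on_def by (simp add: nabla_def with_action_def module.defs sl2_rep.defs free_module_def)

lemma L_mod_eq_nabla_on: "L_mod k = nabla_on k {m. int m \<le> - k}"
  by (auto simp: L_mod_def nabla_on_def intro!: arg_cong[where f = "\<lambda>C. (nabla k)\<lparr>carrier := C\<rparr>"])

lemma stable_UNIV: "stable k UNIV"
  by (simp add: stable_def)

lemma stable_atMost: "stable k {m. int m \<le> - k}"
  by (auto simp: stable_def)

section \<open>The twisted polynomial representation as a tensor product\<close>

lemma update_lookup: "Poly_Mapping.update i (Poly_Mapping.lookup m i) m = m"
  by (rule poly_mapping_eqI) (simp add: lookup_update)

lemma update_Suc_lookup:
  "Poly_Mapping.update i (Suc (Poly_Mapping.lookup m i)) m = m + Poly_Mapping.single i 1"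
  by (rule poly_mapping_eqI) (simp add: lookup_update lookup_add lookup_single)

lemma update_pred_lookup:
  "Poly_Mapping.update i (Poly_Mapping.lookup m i - 1) m = m - Poly_Mapping.single i (1 :: nat)"
  by (rule poly_mapping_eqI) (simp add: lookup_update lookup_minus lookup_single)

lemma slot_nabla_ops:
  "slot m i (dop (nabla k) (gen (Poly_Mapping.lookup m i))) =
    Poly_Mapping.single (m + Poly_Mapping.single i 1) (of_int (int (Poly_Mapping.lookup m i) + k))"
  "slot m i (hop (nabla k) (gen (Poly_Mapping.lookup m i))) =
    Poly_Mapping.single m (of_int (k + 2 * int (Poly_Mapping.lookup m i)))"
  "slot m i (zop (nabla k) (gen (Poly_Mapping.lookup m i))) =
    Poly_Mapping.single (m - Poly_Mapping.single i 1) (of_nat (Poly_Mapping.lookup m i))"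
  by (simp_all add: slot_def nabla_ops_gen update_lookup update_Suc_lookup
      update_pred_lookup[unfolded One_nat_def])

lemma single_sum: "Poly_Mapping.single b (\<Sum>i\<in>I. c i) = (\<Sum>i\<in>I. Poly_Mapping.single b (c i))"
  by (induction I rule: infinite_finite_induct) (auto simp: single_add)

lemma poly_monoms_eq_box: "poly_monoms n = box {1..n} (\<lambda>_. UNIV)"
  by (simp add: poly_monoms_def box_def)

lemma twisted_d:
  "(dop (twisted_poly n a) :: 'k::comm_ring_1 mpoly \<Rightarrow> _) = componentwise {1..n} (\<lambda>i. dop (nabla (a i)))"
proof (rule linear_map_ext)
  show "linear_map (dop (twisted_poly n a) :: 'k mpoly \<Rightarrow> _)"
    by (rule linear_mapI) (simp_all add: twisted_poly_def partial_deriv_def distrib_left distrib_right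
        linear_map_lin_extend[THEN linear_map_add] linear_map_lin_extend[THEN linear_map_scale]
        scale_mult_left scale_mult_right sum.distrib free.scale_sum_right free.scale_right_distrib)
next
  fix m :: "nat \<Rightarrow>\<^sub>0 nat"
  have "(indet i)\<^sup>2 * partial_deriv i (gen m :: 'k mpoly) =
      Poly_Mapping.single (m + Poly_Mapping.single i 1) (of_nat (Poly_Mapping.lookup m i))" for i
  proof (cases "Poly_Mapping.lookup m i = 0")
    \<comment> \<open>The truncated difference \<open>m - e\<^sub>i\<close> is not inverse to adding \<open>e\<^sub>i\<close> when the exponent is \<open>0\<close>, but
      then the coefficient of the derivative is \<open>0\<close>.\<close>
    case False
    then have "Poly_Mapping.single i 1 + Poly_Mapping.single i 1 + (m - Poly_Mapping.single i 1) =
        m + Poly_Mapping.single i 1"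
      by (intro poly_mapping_eqI) (auto simp: lookup_add lookup_minus lookup_single when_def)
    then show ?thesis
      by (simp add: indet_def partial_deriv_def power2_eq_square mult_single)
  qed (simp add: partial_deriv_def)
  moreover have "of_int (a i) * indet i =
      (Poly_Mapping.single (Poly_Mapping.single i 1) (of_int (a i)) :: 'k mpoly)" for i
    by (simp add: indet_def mult_single flip: single_of_int)
  ultimately show "dop (twisted_poly n a) (gen m :: 'k mpoly) =
      componentwise {1..n} (\<lambda>i. dop (nabla (a i))) (gen m)"
    by (simp add: twisted_poly_def linear_form_def componentwise_def slot_nabla_ops sum_distrib_left
        mult_single single_add sum.distrib)
qed (rule linear_map_componentwise)

lemma twisted_z:
  "zop (twisted_poly n a) = componentwise {1..n} (\<lambda>i. zop (nabla (a i)))"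
proof (rule linear_map_ext)
  show "linear_map (zop (twisted_poly n a))"
    by (rule linear_mapI) (simp_all add: twisted_poly_def partial_deriv_def
        linear_map_lin_extend[THEN linear_map_add] linear_map_lin_extend[THEN linear_map_scale]
        sum.distrib free.scale_sum_right)
next
  fix m
  show "zop (twisted_poly n a) (gen m) = componentwise {1..n} (\<lambda>i. zop (nabla (a i))) (gen m)"
    by (simp add: twisted_poly_def partial_deriv_def componentwise_def slot_nabla_ops)
qed (rule linear_map_componentwise)

lemma twisted_h:
  fixes f :: "'k::comm_ring_1 mpoly"
  assumes "Poly_Mapping.keys f \<subseteq> poly_monoms n"
  shows "hop (twisted_poly n a) f = componentwise {1..n} (\<lambda>i. hop (nabla (a i))) f"
proof (rule linear_map_eqI[OF _ linear_map_componentwise _ assms])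
  show "linear_map (hop (twisted_poly n a))"
    by (rule linear_mapI) (simp_all add: twisted_poly_def degree_op_def
        linear_map_lin_extend[THEN linear_map_add] linear_map_lin_extend[THEN linear_map_scale]
        scale_mult_left distrib_right free.scale_right_distrib)
next
  fix m assume "m \<in> poly_monoms n"
  then have "monom_degree m = (\<Sum>i=1..n. 2 * Poly_Mapping.lookup m i)"
    unfolding monom_degree_def poly_monoms_def
    by (intro sum.mono_neutral_left) (auto simp: in_keys_iff)
  then have "of_nat (monom_degree m) + of_int (\<Sum>i=1..n. a i) =
      (\<Sum>i=1..n. of_int (a i + 2 * int (Poly_Mapping.lookup m i)) :: 'k)"
    by (simp add: sum.distrib)
  then show "hop (twisted_poly n a) (gen m :: 'k mpoly) =
      componentwise {1..n} (\<lambda>i. hop (nabla (a i))) (gen m)"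
    by (simp add: twisted_poly_def degree_op_def componentwise_def slot_nabla_ops mult_single
        del: of_int_sum of_int_add flip: single_of_int single_add single_sum)
qed

text \<open>The span of a box of monomials, with the operators of the twisted representation. Both the whole
  representation and its core are of this form.\<close>

definition twisted_on :: "nat \<Rightarrow> (nat \<Rightarrow> int) \<Rightarrow> (nat \<Rightarrow> nat set) \<Rightarrow> ('k::comm_ring_1, 'k mpoly) sl2_rep"
  where "twisted_on n a S = (twisted_poly n a)\<lparr>carrier := {f. Poly_Mapping.keys f \<subseteq> box {1..n} S}\<rparr>"

lemma inside_free_twisted_on: "inside_free (twisted_on n a S)"
  by (simp add: inside_free_def twisted_on_def subspace_keys_subset) (simp add: twisted_poly_def)

theorem twisted_on_iso:
  assumes "\<And>i. i \<in> {1..n} \<Longrightarrow> stable (a i) (S i)"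
  shows "(twisted_on n a S :: ('k::comm_ring_1, 'k mpoly) sl2_rep) \<cong>\<^sub>s\<^sub>l tensor {1..n} (\<lambda>i. nabla_on (a i) (S i))"
proof -
  interpret monomial_family "{1..n}" S "\<lambda>i. nabla_on (a i) (S i) :: ('k, nat \<Rightarrow>\<^sub>0 'k) sl2_rep"
    by unfold_locales (use assms in \<open>auto simp: sl2_module_nabla_on inside_free_nabla_on\<close>)
  have "Poly_Mapping.keys f \<subseteq> poly_monoms n" if "f \<in> carrier (twisted_on n a S)" for f :: "'k mpoly"
    using that by (auto simp: twisted_on_def box_def poly_monoms_def)
  then show ?thesis
    by (intro sl2_iso_tensor inside_free_twisted_on)
      (simp_all add: twisted_on_def twisted_d twisted_h twisted_z)
qed

lemma twisted_poly_eq_twisted_on: "twisted_poly n a = twisted_on n a (\<lambda>_. UNIV)"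
  unfolding twisted_on_def poly_monoms_eq_box[symmetric]
  by (simp add: twisted_poly_def with_action_def module.defs sl2_rep.defs free_module_def)

section \<open>The core\<close>

lemma finite_box:
  assumes "finite I" "\<And>i. i \<in> I \<Longrightarrow> finite (S i)"
  shows "finite (box I S)"
proof (rule finite_imageD)
  show "finite ((\<lambda>m. restrict (Poly_Mapping.lookup m) I) ` box I S)"
    by (rule finite_subset[OF _ finite_PiE[OF assms]]) (auto simp: box_def)
  show "inj_on (\<lambda>m. restrict (Poly_Mapping.lookup m) I) (box I S)"
  proof (rule inj_onI)
    fix m m' assume m: "m \<in> box I S" "m' \<in> box I S"
      and eq: "restrict (Poly_Mapping.lookup m) I = restrict (Poly_Mapping.lookup m') I"
    show "m = m'"
    proof (rule poly_mapping_eqI)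
      fix i
      have "Poly_Mapping.lookup m i = 0" "Poly_Mapping.lookup m' i = 0" if "i \<notin> I"
        using m that by (auto simp: box_def in_keys_iff)
      then show "Poly_Mapping.lookup m i = Poly_Mapping.lookup m' i"
        using fun_cong[OF eq, of i] by (cases "i \<in> I") simp_all
    qed
  qed
qed

text \<open>Among the monomials of \<open>f\<close>, take one whose exponent of \<open>x\<^sub>i\<close> is the largest. The only way to
  reach an exponent larger by one is to apply the \<open>i\<close>-th summand of \<open>d\<close> to such a monomial, so nothing
  cancels, and its coefficient is multiplied by the exponent plus \<open>a\<^sub>i\<close>, which is positive.\<close>

lemma d_raises_top_exponent:
  fixes f :: "'k::{idom, ring_char_0} mpoly"
  assumes i: "i \<in> {1..n}" and m: "m \<in> Poly_Mapping.keys f" "int (Poly_Mapping.lookup m i) > - a i"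
  shows "\<exists>m'\<in>Poly_Mapping.keys (dop (twisted_poly n a) f).
    Poly_Mapping.lookup m i < Poly_Mapping.lookup m' i"
proof -
  let ?e = "\<lambda>i. Poly_Mapping.single i (1 :: nat)"
  define N where "N = Max ((\<lambda>m. Poly_Mapping.lookup m i) ` Poly_Mapping.keys f)"
  have N: "Poly_Mapping.lookup m i \<le> N" if "m \<in> Poly_Mapping.keys f" for m
    using that by (auto simp: N_def)
  have "N \<in> (\<lambda>m. Poly_Mapping.lookup m i) ` Poly_Mapping.keys f"
    unfolding N_def using m(1) by (intro Max_in) auto
  then obtain t where t: "t \<in> Poly_Mapping.keys f" "Poly_Mapping.lookup t i = N" by auto
  \<comment> \<open>If \<open>j \<noteq> i\<close>, then \<open>m' + ?e j = t + ?e i\<close> would give \<open>m'\<close> the exponent \<open>N + 1\<close> at \<open>i\<close>.\<close>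
  have "Poly_Mapping.lookup (Poly_Mapping.single (m' + ?e j) c) (t + ?e i) =
      (if m' = t \<and> j = i then c else (0 :: 'k))"
    if "m' \<in> Poly_Mapping.keys f" for m' j c
  proof (cases "m' + ?e j = t + ?e i")
    case True
    then have "Poly_Mapping.lookup (m' + ?e j) i = Poly_Mapping.lookup (t + ?e i) i" by simp
    then have "j = i"
      using N[OF that] t(2) by (auto simp: lookup_add lookup_single when_def split: if_splits)
    then show ?thesis using True by simp
  qed (auto simp: lookup_single)
  then have "Poly_Mapping.lookup (dop (twisted_poly n a) f) (t + ?e i) =
      (\<Sum>m\<in>Poly_Mapping.keys f. Poly_Mapping.lookup f m * (\<Sum>j=1..n.
        if m = t \<and> j = i then of_int (int (Poly_Mapping.lookup m j) + a j) else 0))"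
    unfolding twisted_d componentwise_def slot_nabla_ops lin_extend_def
    by (simp add: lookup_sum del: of_int_add)
  also have "\<dots> = (\<Sum>m\<in>Poly_Mapping.keys f. if m = t
      then Poly_Mapping.lookup f t * of_int (int (Poly_Mapping.lookup t i) + a i) else 0)"
    using i by (intro sum.cong refl) (simp del: of_int_add)
  also have "\<dots> = Poly_Mapping.lookup f t * of_int (int (Poly_Mapping.lookup t i) + a i)"
    using t(1) by simp
  also have "\<dots> \<noteq> 0"
    using t m N[OF m(1)] by (simp add: in_keys_iff del: of_int_add)
  finally have "t + ?e i \<in> Poly_Mapping.keys (dop (twisted_poly n a) f)"
    by (simp add: in_keys_iff)
  moreover have "Poly_Mapping.lookup m i < Poly_Mapping.lookup (t + ?e i) i"
    using N[OF m(1)] t(2) by (simp add: lookup_add)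
  ultimately show ?thesis by blast
qed

abbreviation core_monoms :: "nat \<Rightarrow> (nat \<Rightarrow> int) \<Rightarrow> (nat \<Rightarrow>\<^sub>0 nat) set"
  where "core_monoms n a \<equiv> box {1..n} (\<lambda>i. {m. int m \<le> - a i})"

lemma inside_free_twisted_poly: "inside_free (twisted_poly n a)"
  by (simp add: twisted_poly_eq_twisted_on inside_free_twisted_on)

lemma carrier_twisted_poly: "carrier (twisted_poly n a) = {f. Poly_Mapping.keys f \<subseteq> poly_monoms n}"
  by (simp add: twisted_poly_def)

text \<open>The exponents of \<open>x\<^sub>i\<close> are bounded on a finitely generated submodule, whereas iterating \<open>d\<close> on an
  element with a monomial whose \<open>x\<^sub>i\<close>-exponent exceeds \<open>- a\<^sub>i\<close> would make them unbounded.\<close>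

lemma finitely_generated_below_core:
  fixes C :: "'k::{idom, ring_char_0} mpoly set"
  assumes C: "sl2_submodule C (twisted_poly n a)" "finitely_generated C (twisted_poly n a)"
  shows "C \<subseteq> {f. Poly_Mapping.keys f \<subseteq> core_monoms n a}"
proof (intro subsetI CollectI)
  fix f m assume f: "f \<in> C" and m: "m \<in> Poly_Mapping.keys f"
  obtain A where A: "A \<subseteq> carrier (twisted_poly n a)" "finite A" "C = free.span A"
    using C(2) unfolding finitely_generated_def
    by (metis submodule_span_eq_span[OF inside_free_twisted_poly])
  have d: "dop (twisted_poly n a) g \<in> C" if "g \<in> C" for g
    using C(1) that by (auto simp: sl2_submodule_def)
  have "C \<subseteq> carrier (twisted_poly n a)"
    using C(1) by (simp add: sl2_submodule_def submodule_iff_subspace inside_free_twisted_poly)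
  then have keys: "Poly_Mapping.keys g \<subseteq> poly_monoms n" if "g \<in> C" for g
    using that by (auto simp: carrier_twisted_poly)
  have False if i: "i \<in> {1..n}" and mi: "int (Poly_Mapping.lookup m i) > - a i" for i
  proof -
    define N where "N = Max ((\<lambda>m. Poly_Mapping.lookup m i) ` (\<Union>g\<in>A. Poly_Mapping.keys g))"
    have "A \<subseteq> {g. Poly_Mapping.keys g \<subseteq> {m. Poly_Mapping.lookup m i \<le> N}}"
      using A(2) by (auto simp: N_def intro!: Max_ge)
    then have "C \<subseteq> {g. Poly_Mapping.keys g \<subseteq> {m. Poly_Mapping.lookup m i \<le> N}}"
      unfolding A(3) by (intro free.span_minimal subspace_keys_subset)
    moreover have "\<exists>g\<in>C. \<exists>m\<in>Poly_Mapping.keys g. k \<le> Poly_Mapping.lookup m i \<and>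
        int (Poly_Mapping.lookup m i) > - a i" for k
    proof (induction k)
      case 0
      show ?case using f m mi by blast
    next
      case (Suc k)
      then obtain g m where g: "g \<in> C" "m \<in> Poly_Mapping.keys g" "k \<le> Poly_Mapping.lookup m i"
          "int (Poly_Mapping.lookup m i) > - a i" by blast
      from d_raises_top_exponent[where a = a, OF i g(2,4)]
      obtain m' where "m' \<in> Poly_Mapping.keys (dop (twisted_poly n a) g)"
          "Poly_Mapping.lookup m i < Poly_Mapping.lookup m' i" by blast
      then show ?case
        using d[OF g(1)] g(3,4)
        by (intro bexI[of _ "dop (twisted_poly n a) g"] bexI[of _ m']) simp_all
    qed
    from this[of "Suc N"] obtain g m where "g \<in> C" "m \<in> Poly_Mapping.keys g"
        "Suc N \<le> Poly_Mapping.lookup m i" by blast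
    ultimately show False by force
  qed
  moreover have "Poly_Mapping.keys m \<subseteq> {1..n}"
    using keys[OF f] m by (auto simp: poly_monoms_def)
  ultimately show "m \<in> core_monoms n a" by (force simp: box_def)
qed

text \<open>The coefficient \<open>m + a\<^sub>i\<close> vanishes at \<open>m = - a\<^sub>i\<close>, so \<open>d\<close> cannot leave the box of exponents
  \<open>m \<le> - a\<^sub>i\<close>, and the box is finite.\<close>

lemma core_monoms_generate:
  shows "sl2_submodule {f :: 'k::comm_ring_1 mpoly. Poly_Mapping.keys f \<subseteq> core_monoms n a} (twisted_poly n a)"
    (is "sl2_submodule ?K ?R")
  and "finitely_generated {f :: 'k::comm_ring_1 mpoly. Poly_Mapping.keys f \<subseteq> core_monoms n a}
    (twisted_poly n a)"
proof -
  have K: "?K \<subseteq> carrier ?R"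
    by (auto simp: carrier_twisted_poly box_def poly_monoms_def)
  have closed: "componentwise {1..n} (\<lambda>i. \<xi> (nabla (a i))) f \<in> ?K"
    if "\<xi> \<in> {dop, hop, zop}" "f \<in> ?K"
    for \<xi> :: "('k, nat \<Rightarrow>\<^sub>0 'k) sl2_rep \<Rightarrow> (nat \<Rightarrow>\<^sub>0 'k) \<Rightarrow> (nat \<Rightarrow>\<^sub>0 'k)" and f
  proof -
    have "Poly_Mapping.keys (\<xi> (nabla (a i)) x) \<subseteq> {m. int m \<le> - a i}"
      if "Poly_Mapping.keys x \<subseteq> {m. int m \<le> - a i}" for i x
      using \<open>\<xi> \<in> _\<close> nabla_ops_keys[OF stable_atMost that] by (elim insertE) simp_all
    then show ?thesis
      using that(2) keys_componentwise[of "{1..n}" "\<lambda>i. {m. int m \<le> - a i}" "\<lambda>i. \<xi> (nabla (a i))" f]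
      by simp
  qed
  have h: "hop ?R f = componentwise {1..n} (\<lambda>i. hop (nabla (a i))) f" if "f \<in> ?K" for f
    using K that by (intro twisted_h) (auto simp: carrier_twisted_poly)
  show "sl2_submodule ?K ?R"
    unfolding sl2_submodule_def twisted_d twisted_z
  proof (intro conjI funcsetI)
    show "submodule ?K base_ring ?R"
      using K by (simp add: submodule_iff_subspace[OF inside_free_twisted_poly] subspace_keys_subset)
    show "hop ?R f \<in> ?K" if "f \<in> ?K" for f
      unfolding h[OF that] using that by (intro closed) simp_all
  qed (simp_all only: closed insert_iff simp_thms)
  have "finite {m. int m \<le> - a i}" for i
    by (rule finite_subset[of _ "{..nat (- a i)}"]) auto
  then have "finite (core_monoms n a)" by (intro finite_box) auto
  moreover have "gen ` core_monoms n a \<subseteq> carrier ?R"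
    using K by (intro order_trans[OF _ K]) auto
  ultimately show "finitely_generated ?K ?R"
    unfolding finitely_generated_def
    by (intro exI[of _ "gen ` core_monoms n a"])
      (simp add: submodule_span_eq_span[OF inside_free_twisted_poly] keys_subset_eq_span)
qed

text \<open>The box spans a finitely generated submodule stable under sl2, and every other such submodule
  is contained in it. If some \<open>a\<^sub>i\<close>
  is positive, the box is empty and the core is zero.\<close>

theorem core_twisted_poly:
  "core (twisted_poly n a) =
    {f :: 'k::{idom, ring_char_0} mpoly. Poly_Mapping.keys f \<subseteq> core_monoms n a}"
  unfolding core_def
proof (rule Greatest_equality)
  show "C \<subseteq> {f :: 'k mpoly. Poly_Mapping.keys f \<subseteq> core_monoms n a}"
    if "sl2_submodule C (twisted_poly n a) \<and> finitely_generated C (twisted_poly n a)" for C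
    using that by (elim conjE) (rule finitely_generated_below_core)
qed (intro conjI core_monoms_generate)

lemma core_nonzero_iff:
  "{f :: 'k::comm_ring_1 mpoly. Poly_Mapping.keys f \<subseteq> core_monoms n a} \<noteq> {0} \<longleftrightarrow>
    (\<forall>i\<in>{1..n}. a i \<le> 0)"
proof
  assume "{f :: 'k mpoly. Poly_Mapping.keys f \<subseteq> core_monoms n a} \<noteq> {0}"
  then obtain f :: "'k mpoly" where "Poly_Mapping.keys f \<subseteq> core_monoms n a" "f \<noteq> 0" by auto
  then obtain m where "m \<in> core_monoms n a" by fastforce
  then show "\<forall>i\<in>{1..n}. a i \<le> 0" by (force simp: box_def)
next
  assume "\<forall>i\<in>{1..n}. a i \<le> 0"
  then have "(1 :: 'k mpoly) \<in> {f. Poly_Mapping.keys f \<subseteq> core_monoms n a}"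
    by (auto simp: box_def)
  then show "{f :: 'k mpoly. Poly_Mapping.keys f \<subseteq> core_monoms n a} \<noteq> {0}"
    by (metis singletonD zero_neq_one)
qed

theorem proposition1p23:
  fixes n :: nat and a :: "nat \<Rightarrow> int"
    and R :: "('k::{idom, ring_char_0}, 'k mpoly) sl2_rep"
  assumes noetherian: "noetherian_ring (base_ring :: 'k ring)"
    and R: "R = twisted_poly n a"
  shows "R \<cong>\<^sub>s\<^sub>l tensor {1..n} (\<lambda>i. nabla (a i)) \<and>
    (core R \<noteq> {\<zero>\<^bsub>R\<^esub>} \<longleftrightarrow> (\<forall>i\<in>{1..n}. a i \<le> 0)) \<and>
    ((\<forall>i\<in>{1..n}. a i \<le> 0) \<longrightarrow> sl2_core R \<cong>\<^sub>s\<^sub>l tensor {1..n} (\<lambda>i. L_mod (a i)))"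
proof (intro conjI impI)
  show "R \<cong>\<^sub>s\<^sub>l tensor {1..n} (\<lambda>i. nabla (a i))"
    unfolding R twisted_poly_eq_twisted_on nabla_eq_nabla_on
    by (rule twisted_on_iso) (rule stable_UNIV)
  have "\<zero>\<^bsub>R\<^esub> = 0" by (simp add: R twisted_poly_def)
  then show "core R \<noteq> {\<zero>\<^bsub>R\<^esub>} \<longleftrightarrow> (\<forall>i\<in>{1..n}. a i \<le> 0)"
    by (simp only: R core_twisted_poly core_nonzero_iff)
  have "sl2_core R = twisted_on n a (\<lambda>i. {m. int m \<le> - a i})"
    by (simp add: sl2_core_def twisted_on_def R core_twisted_poly)
  then show "sl2_core R \<cong>\<^sub>s\<^sub>l tensor {1..n} (\<lambda>i. L_mod (a i))"
    by (simp only: L_mod_eq_nabla_on) (rule twisted_on_iso, rule stable_atMost)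
qed

end
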